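(* Let $m\ge1$, $\mathbf p\in\mathbb N_0^{2m}$ and $P=\sum_{i=1}^{2m}p_i$. The action, under the semi-classical OPE of the twistor sigma model, of the conformally soft hyperkähler charge $Q[\mathbf p](z)$ on a generic (hard) conformal primary hyperkähler graviton $h_\Delta$ is $$Q[\mathbf p](z)\,h_\Delta(Z;z',\tilde z)\sim\frac{i^{P-2}}{\langle z\,z'\rangle}\,\frac{\langle\iota\,\lambda\rangle^{2-P}\,\langle\iota\,z'\rangle}{\langle\iota\,z\rangle^{3-P}}\,\{w[\mathbf p],h_\Delta(Z;z',\tilde z)\}\sim\frac{i^{P-2}}{z-z'}\,\frac{\{w[\mathbf p],h_\Delta(Z;z',\tilde z)\}}{\langle\iota\,\lambda\rangle^{P-2}},$$ the second form holding on the patch where $\langle\iota\,z\rangle=1=\langle\iota\,z'\rangle$. On the patch $\tilde z_{\dot\alpha}=(1,\tilde z_2,\dots,\tilde z_{2m})$ this becomes the celestial OPE $$\begin{aligned}Q[\mathbf p](z)\,h_\Delta(z',\tilde z)\sim\frac{-(-1)^{P-p_1}}{z-z'}\Big[&\,p_1\,\tilde z_{m+1}\Big(\prod_{r=0}^{p_1-2}(\tilde\Upsilon+\Delta-2-r)\Big)\prod_{b=2}^{2m}\tilde\partial_b^{\,p_b}\\&-p_{1+m}\Big(\prod_{r=0}^{p_1-1}(\tilde\Upsilon+\Delta-2-r)\Big)\tilde\partial_{1+m}^{\,p_{1+m}-1}\prod_{b\ne1,1+m}\tilde\partial_b^{\,p_b}\\&+\sum_{i=2}^m\Big(p_i\,\tilde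 z_{i+m}\Big(\prod_{r=0}^{p_1-1}(\tilde\Upsilon+\Delta-2-r)\Big)\tilde\partial_i^{\,p_i-1}\prod_{b\neq1,i}\tilde\partial_b^{\,p_b}\\&\qquad\;-p_{i+m}\,\tilde z_i\Big(\prod_{r=0}^{p_1-1}(\tilde\Upsilon+\Delta-2-r)\Big)\tilde\partial_{i+m}^{\,p_{i+m}-1}\prod_{b\ne1,i+m}\tilde\partial_b^{\,p_b}\Big)\Big]h_{\Delta-P+2}(z,\tilde z).\end{aligned}$$
   Context: $Z=(\mu^{\dot\alpha},\lambda_\alpha)$, with $\alpha\in\{0,1\}$ and $\dot\alpha\in\{1,\dots,2m\}$, are homogeneous coordinates on the flat twistor space $\{[Z]\in\mathbb P^{2m+1}\,|\,\lambda_\alpha\neq0\}$. Indices are raised and lowered with the standard symplectic forms ($a_\beta=a^\alpha\varepsilon_{\alpha\beta}$, $a^\alpha=\varepsilon^{\alpha\beta}a_\beta$, $\varepsilon_{01}=1$; similarly for dotted indices with $\varepsilon_{\dot\alpha\dot\beta}$ of block form $\begin{pmatrix}0&\mathbb 1_m\\-\mathbb 1_m&0\end{pmatrix}$). Set $\langle a\,b\rangle=a^\alpha b_\alpha$, $[\tilde a\,\tilde b]=\tilde a^{\dot\alpha}\tilde b_{\dot\alpha}$, $D\lambda=\langle\lambda\,d\lambda\rangle$. The Poisson bracket is $\{f,g\}=\varepsilon^{\dot\alpha\dot\beta}\partial_{\mu^{\dot\alpha}}f\,\partial_{\mu^{\dot\beta}}g$. The constant spinors $o,\iota$ obey $\langle\iota\,o\rangle=1$,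 with $\iota_\alpha=(0,1)$; affine coordinates are $\lambda_\alpha=(1,\lambda)$, $z_\alpha=(1,z)$. Set $w[\mathbf p]=(\mu^{\dot1})^{p_1}\cdots(\mu^{\dot{2m}})^{p_{2m}}$. A hyperkähler graviton has momentum $k^{\alpha\dot\alpha}=\omega\,z^\alpha\tilde z^{\dot\alpha}$, with $z^\alpha$ and $\tilde z^{\dot\alpha}$ homogeneous coordinates on $\mathbb P^1$ and $\mathbb P^{2m-1}$. Its conformal primary twistor wavefunction of dimension $\Delta$ (the Mellin transform in $\omega$ of the momentum eigenstate) is $$h_\Delta(Z;z,\tilde z)=\frac{(-i)^{-\Delta}\,\Gamma(\Delta-2)}{[\mu\,\tilde z]^{\Delta-2}}\,\bar\delta_\Delta(\langle\lambda\,z\rangle),\qquad \bar\delta_\Delta(\langle\lambda\,z\rangle)=\Big(\frac{\langle\iota\,\lambda\rangle}{\langle\iota\,z\rangle}\Big)^{\Delta+1}\frac{1}{2\pi i}\,\bar\partial\Big(\frac1{\langle\lambda\,z\rangle}\Big).$$ In the purely celestial formula the dependence on $Z$ is suppressed. The soft charge is $$Q[\mathbf p](z)=\frac{i^{P-2}}{2\pi i}\oint_{\gamma_z}\frac{w[\mathbf p]\,\langle\iota\,\lambda\rangle^{3-P}}{\langle\lambda\,z\rangle\,\langle\iota\,z\rangle^{3-P}}\,\frac{D\lambda}{\langle\lambda\,o\rangle^2\langle\lambda\,\iota\rangle^2},$$ with $\gamma_z$ a small circle around $\langle\lambda\,z\rangle=0$. It acts by a single Wick contraction using the OPE $$\mu^{\dot\alpha}(\lambda)\,\mu^{\dot\beta}(\lambda')\sim\frac{\varepsilon^{\dot\alpha\dot\beta}}{\langle\lambda\,\lambda'\rangle}\,\langle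 o\,\lambda\rangle\langle\iota\,\lambda\rangle\langle o\,\lambda'\rangle\langle\iota\,\lambda'\rangle,$$ the contour in the charge's integration variable then being deformed to surround the pole of this OPE, and the support of the delta function in $h_\Delta$ being used. $\tilde\partial_a=\partial/\partial\tilde z_a$ for $a=2,\dots,2m$, and $\tilde\Upsilon=\sum_{a=2}^{2m}\tilde z_a\tilde\partial_a$. Products over $b$ run over $b\in\{2,\dots,2m\}$ with the indicated exclusions. The symbol $\sim$ denotes the singular part of the OPE.
   Formalization: Signs of the celestial OPE are corrected: prefactor −(−1)^{p_1}, bracket p_1(…)+p_{1+m}(…)−Σ(…); the printed signs contradict the first form (e.g. m=1, p=(1,0)). Assumed: ⟨z' o⟩≠0, [μ z̃] off the branch cut, Gamma factors finite. *)

theory Defs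
  imports
    "HOL-Complex_Analysis.Complex_Analysis"
    "HOL-Library.Landau_Symbols"
begin

section \<open>Spinors and dotted indices\<close>

text \<open>A spinor is given by its lower components (\<open>a\<^sub>0\<close>, \<open>a\<^sub>1\<close>).  With \<open>\<epsilon>\<^sub>0\<^sub>1 = 1\<close> and the stated
  raising rule, \<open>a\<^sup>0 = a\<^sub>1\<close> and \<open>a\<^sup>1 = - a\<^sub>0\<close>, which gives the formula for
  \<open>\<langle>a b\<rangle> = a\<^sup>\<alpha> b\<^sub>\<alpha>\<close>.  In particular \<open>\<langle>(1,x) (1,y)\<rangle> = x - y\<close>.\<close>

type_synonym spinor = "complex \<times> complex"

definition angle :: "spinor \<Rightarrow> spinor \<Rightarrow> complex" where
  "angle a b = snd a * fst b - fst a * snd b"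

definition iota :: spinor where
  "iota = (0, 1)"

definition scale :: "complex \<Rightarrow> spinor \<Rightarrow> spinor" where
  "scale c l = (c * fst l, c * snd l)"

text \<open>The homogeneous coordinates \<open>\<lambda>\<^sub>\<alpha> = s (1, t)\<close> over the point \<open>t\<close> of the chart
  \<open>\<langle>\<iota> \<lambda>\<rangle> \<noteq> 0\<close>; there \<open>\<langle>\<iota> \<lambda>\<rangle> = s\<close>.  Keeping the scale \<open>s\<close> arbitrary keeps track of homogeneity.\<close>

definition sect :: "complex \<Rightarrow> complex \<Rightarrow> spinor" where
  "sect s t = (s, s * t)"

definition aff_coord :: "spinor \<Rightarrow> complex" where
  "aff_coord l = snd l / fst l"

text \<open>Dotted indices run over \<open>{1..2 * m}\<close>; the vectors \<open>\<mu>\<close> (upper index) and \<open>z\<close> (lower index)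
  are functions on \<open>nat\<close> of which only these values are used.  The stated raising and lowering
  rules make \<open>\<epsilon>\<close> with upper indices the same matrix as \<open>\<epsilon>\<close> with lower indices.\<close>

definition eps :: "nat \<Rightarrow> nat \<Rightarrow> nat \<Rightarrow> complex" where
  "eps m a b = (if a \<in> {1..m} \<and> b = a + m then 1
                else if b \<in> {1..m} \<and> a = b + m then - 1 else 0)"

definition sq :: "nat \<Rightarrow> (nat \<Rightarrow> complex) \<Rightarrow> (nat \<Rightarrow> complex) \<Rightarrow> complex" where
  "sq m \<mu> zt = (\<Sum>a\<in>{1..2 * m}. \<mu> a * zt a)"

definition pd :: "nat \<Rightarrow> ((nat \<Rightarrow> complex) \<Rightarrow> complex) \<Rightarrow> (nat \<Rightarrow> complex) \<Rightarrow> complex" where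
  "pd a f x = deriv (\<lambda>u. f (x(a := u))) (x a)"

definition poisson ::
  "nat \<Rightarrow> ((nat \<Rightarrow> complex) \<Rightarrow> complex) \<Rightarrow> ((nat \<Rightarrow> complex) \<Rightarrow> complex) \<Rightarrow> (nat \<Rightarrow> complex) \<Rightarrow> complex"
where
  "poisson m f g \<mu> = (\<Sum>a\<in>{1..2 * m}. \<Sum>b\<in>{1..2 * m}. eps m a b * pd a f \<mu> * pd b g \<mu>)"

definition wt :: "nat \<Rightarrow> (nat \<Rightarrow> nat) \<Rightarrow> nat" where
  "wt m p = (\<Sum>a\<in>{1..2 * m}. p a)"

definition wmon :: "nat \<Rightarrow> (nat \<Rightarrow> nat) \<Rightarrow> (nat \<Rightarrow> complex) \<Rightarrow> complex" where
  "wmon m p \<mu> = (\<Prod>a\<in>{1..2 * m}. \<mu> a ^ p a)"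


section \<open>Currents in the variable \<open>\<lambda>\<close>\<close>

text \<open>A (0,1)-form with distributional coefficient on the chart is identified with the
  coefficient of \<open>d\<lambda>\<close>-bar, a functional on compactly supported test functions.  All
  distributions below have order at most one, so continuously differentiable test functions
  are used.\<close>

type_synonym current = "(complex \<Rightarrow> complex) \<Rightarrow> complex"

definition test_fun :: "(complex \<Rightarrow> complex) \<Rightarrow> bool" where
  "test_fun \<phi> \<longleftrightarrow> (\<forall>t. \<phi> differentiable (at t)) \<and>
     (\<forall>v. continuous_on UNIV (\<lambda>t. frechet_derivative \<phi> (at t) v)) \<and> bounded {t. \<phi> t \<noteq> 0}"

definition dbar_fun :: "(complex \<Rightarrow> complex) \<Rightarrow> complex \<Rightarrow> complex" where
  "dbar_fun \<phi> t = (frechet_derivative \<phi> (at t) 1 + \<i> * frechet_derivative \<phi> (at t) \<i>) / 2"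

definition dbar :: "(complex \<Rightarrow> complex) \<Rightarrow> current" where
  "dbar u \<phi> = - (LINT t|lborel. u t * dbar_fun \<phi> t)"

definition cur_supp :: "current \<Rightarrow> complex set" where
  "cur_supp T = {t. \<forall>U. open U \<and> t \<in> U \<longrightarrow>
     (\<exists>\<phi>. test_fun \<phi> \<and> closure {x. \<phi> x \<noteq> 0} \<subseteq> U \<and> T \<phi> \<noteq> 0)}"

text \<open>The product \<open>f T\<close> needs \<open>f\<close> to be regular near the support of \<open>T\<close> only (\<open>f\<close> may have poles
  elsewhere): \<open>f \<phi>\<close> is replaced by any test function that agrees with it near the support.\<close>

definition mult_current :: "(complex \<Rightarrow> complex) \<Rightarrow> current \<Rightarrow> current" where
  "mult_current f T \<phi> = (THE c. \<exists>\<psi> U. test_fun \<psi> \<and> open U \<and> cur_supp T \<subseteq> U \<and>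
     (\<forall>t\<in>U. \<psi> t = f t * \<phi> t) \<and> T \<psi> = c)"

text \<open>Equality of singular parts along the filter \<open>F\<close>, tested in \<open>\<lambda>\<close>.\<close>

definition ope_sim :: "'a filter \<Rightarrow> ('a \<Rightarrow> current) \<Rightarrow> ('a \<Rightarrow> current) \<Rightarrow> bool" where
  "ope_sim F A B \<longleftrightarrow> (\<forall>\<phi>. test_fun \<phi> \<longrightarrow> (\<lambda>x. A x \<phi> - B x \<phi>) \<in> O[F](\<lambda>_. 1))"


section \<open>Conformal primary wavefunctions\<close>

definition delta_bar :: "complex \<Rightarrow> complex \<Rightarrow> spinor \<Rightarrow> current" where
  "delta_bar \<Delta> s z =
     mult_current (\<lambda>t. (angle iota (sect s t) / angle iota z) powr (\<Delta> + 1))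
       (\<lambda>\<phi>. 1 / (2 * pi * \<i>) * dbar (\<lambda>t. 1 / angle (sect s t) z) \<phi>)"

text \<open>Complex powers are principal.  As a function on twistor space the wavefunction depends on
  the independent variables \<open>\<mu>\<close> (an argument) and \<open>\<lambda> = s (1, t)\<close> (as a current in \<open>t\<close>).\<close>

definition cpw :: "nat \<Rightarrow> complex \<Rightarrow> complex \<Rightarrow> spinor \<Rightarrow> (nat \<Rightarrow> complex) \<Rightarrow> (nat \<Rightarrow> complex) \<Rightarrow> current"
where
  "cpw m \<Delta> s z zt \<mu> \<phi> =
     (- \<i>) powr (- \<Delta>) * Gamma (\<Delta> - 2) / sq m \<mu> zt powr (\<Delta> - 2) * delta_bar \<Delta> s z \<phi>"

definition poisson_current ::
  "nat \<Rightarrow> ((nat \<Rightarrow> complex) \<Rightarrow> complex) \<Rightarrow> ((nat \<Rightarrow> complex) \<Rightarrow> current) \<Rightarrow> (nat \<Rightarrow> complex) \<Rightarrow> current"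
where
  "poisson_current m f H \<mu> \<phi> = poisson m f (\<lambda>\<nu>. H \<nu> \<phi>) \<mu>"


section \<open>The soft charge and its action by a single Wick contraction\<close>

text \<open>The contour integral of the charge over a small circle around \<open>t\<^sub>0\<close>, with \<open>w[p]\<close> replaced by a
  homogeneous function \<open>F\<close> of \<open>\<lambda>\<close>.  The integrand is homogeneous of degree zero, so it is
  evaluated on \<open>\<lambda> = (1, t)\<close>, where \<open>d\<lambda> = (0, 1) dt\<close>; the factor \<open>angle (sect 1 t) (0, 1)\<close> is
  \<open>D\<lambda>/dt\<close>.  A residue is the integral over a small circle divided by \<open>2 \<pi> i\<close>.\<close>

definition contour_charge ::
  "nat \<Rightarrow> spinor \<Rightarrow> (nat \<Rightarrow> nat) \<Rightarrow> spinor \<Rightarrow> (spinor \<Rightarrow> complex) \<Rightarrow> complex \<Rightarrow> complex"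
where
  "contour_charge m osp p z F t0 =
     \<i> powi (int (wt m p) - 2) *
     residue (\<lambda>t. let l = sect 1 t in
        F l * angle iota l powi (3 - int (wt m p)) /
          (angle l z * angle iota z powi (3 - int (wt m p))) *
        (angle l (0, 1) / ((angle l osp)\<^sup>2 * (angle l iota)\<^sup>2))) t0"

definition soft_charge ::
  "nat \<Rightarrow> spinor \<Rightarrow> (nat \<Rightarrow> nat) \<Rightarrow> spinor \<Rightarrow> (spinor \<Rightarrow> nat \<Rightarrow> complex) \<Rightarrow> complex"
where
  "soft_charge m osp p z X = contour_charge m osp p z (\<lambda>l. wmon m p (X l)) (aff_coord z)"

definition mu_ope :: "nat \<Rightarrow> spinor \<Rightarrow> nat \<Rightarrow> nat \<Rightarrow> spinor \<Rightarrow> spinor \<Rightarrow> complex" where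
  "mu_ope m osp a b l l' =
     eps m a b / angle l l' * (angle osp l * angle iota l * angle osp l' * angle iota l')"

text \<open>A field configuration \<open>\<mu>(\<lambda>)\<close>, homogeneous of degree one, that is holomorphic near
  the insertion point and passes through the twistor \<open>(\<mu>, l)\<close> there.\<close>

definition field_through ::
  "nat \<Rightarrow> (spinor \<Rightarrow> nat \<Rightarrow> complex) \<Rightarrow> (nat \<Rightarrow> complex) \<Rightarrow> spinor \<Rightarrow> bool"
where
  "field_through m X \<mu> l \<longleftrightarrow> (\<forall>a\<in>{1..2 * m}.
     (\<forall>c k. c \<noteq> 0 \<longrightarrow> X (scale c k) a = c * X k a) \<and>
     (\<lambda>t. X (sect 1 t) a) analytic_on {aff_coord l} \<and> X l a = \<mu> a)"

text \<open>The charge acts on a wavefunction \<open>H\<close> at \<open>(\<mu>, \<lambda>')\<close>, \<open>\<lambda>' = s (1, t)\<close>: one factor \<open>\<mu>\<close> of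
  \<open>w[p]\<close> is contracted with \<open>H\<close>, and the charge's contour surrounds the pole at \<open>\<lambda>'\<close> once,
  counterclockwise in the affine coordinate.  \<open>X l'\<close> is the field configuration for an
  insertion at \<open>l'\<close>; its value at the integration point is the argument of the uncontracted
  factors.\<close>

definition charge_action ::
  "nat \<Rightarrow> spinor \<Rightarrow> (nat \<Rightarrow> nat) \<Rightarrow> spinor \<Rightarrow> complex \<Rightarrow> (spinor \<Rightarrow> spinor \<Rightarrow> nat \<Rightarrow> complex) \<Rightarrow>
   ((nat \<Rightarrow> complex) \<Rightarrow> current) \<Rightarrow> (nat \<Rightarrow> complex) \<Rightarrow> current"
where
  "charge_action m osp p z s X H \<mu> \<phi> =
     (\<Sum>b\<in>{1..2 * m}.
        mult_current
          (\<lambda>t. contour_charge m osp p z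
                 (\<lambda>l. \<Sum>a\<in>{1..2 * m}. pd a (wmon m p) (X (sect s t) l) * mu_ope m osp a b l (sect s t)) t)
          (\<lambda>\<psi>. pd b (\<lambda>\<nu>. H \<nu> \<psi>) \<mu>) \<phi>)"


section \<open>The celestial operator\<close>

definition upsilon :: "nat \<Rightarrow> ((nat \<Rightarrow> complex) \<Rightarrow> complex) \<Rightarrow> (nat \<Rightarrow> complex) \<Rightarrow> complex" where
  "upsilon m g zt = (\<Sum>a\<in>{2..2 * m}. zt a * pd a g zt)"

text \<open>The product over \<open>r < n\<close> of \<open>\<Upsilon> + \<Delta> - 2 - r\<close>.\<close>

definition ups_prod ::
  "nat \<Rightarrow> complex \<Rightarrow> nat \<Rightarrow> ((nat \<Rightarrow> complex) \<Rightarrow> complex) \<Rightarrow> (nat \<Rightarrow> complex) \<Rightarrow> complex"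
where
  "ups_prod m \<Delta> n =
     foldr (\<lambda>r A. (\<lambda>g zt. upsilon m g zt + (\<Delta> - 2 - of_nat r) * g zt) \<circ> A) [0..<n] id"

text \<open>The product over \<open>b \<in> {2..2 * m} - B\<close> of the \<open>p b\<close>-th powers of the partial derivatives.\<close>

definition pd_prod ::
  "nat \<Rightarrow> (nat \<Rightarrow> nat) \<Rightarrow> nat set \<Rightarrow> ((nat \<Rightarrow> complex) \<Rightarrow> complex) \<Rightarrow> (nat \<Rightarrow> complex) \<Rightarrow> complex"
where
  "pd_prod m p B =
     foldr (\<lambda>b A. (pd b ^^ p b) \<circ> A) (filter (\<lambda>b. b \<notin> B) [2..<2 * m + 1]) id"

text \<open>The signs come from \<open>\<mu>\<^sup>1 h\<^bsub>\<Delta>+1\<^esub> = i (\<Upsilon> + \<Delta> - 2) h\<^bsub>\<Delta>\<^esub>\<close> on the patch \<open>z\<^sub>1 = 1\<close>,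
  \<open>\<mu>\<^sup>a h\<^bsub>\<Delta>+1\<^esub> = - i \<partial>\<^sub>a h\<^bsub>\<Delta>\<^esub>\<close> for \<open>a \<ge> 2\<close>, and \<open>\<partial>h\<^bsub>\<Delta>\<^esub>/\<partial>\<mu>\<^sup>b = i z\<^sub>b h\<^bsub>\<Delta>+1\<^esub>\<close>.
  The source prints the prefactor as \<open>-(-1)\<^bsup>P - p\<^sub>1\<^esup>\<close> and the bracket as
  \<open>p\<^sub>1 (\<dots>) - p\<^bsub>m+1\<^esub> (\<dots>) + \<Sum> (\<dots>)\<close>.  With its own definitions of \<open>h\<^bsub>\<Delta>\<^esub>\<close> and of the bracket, the
  prefactor is \<open>-(-1)\<^bsup>p\<^sub>1\<^esup>\<close> and the sign of all terms after the first is reversed, as here.\<close>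

definition celestial_op ::
  "nat \<Rightarrow> (nat \<Rightarrow> nat) \<Rightarrow> complex \<Rightarrow> ((nat \<Rightarrow> complex) \<Rightarrow> complex) \<Rightarrow> (nat \<Rightarrow> complex) \<Rightarrow> complex"
where
  "celestial_op m p \<Delta> g zt =
     - ((- 1) ^ p 1) *
     (of_nat (p 1) * zt (m + 1) * ups_prod m \<Delta> (p 1 - 1) (pd_prod m p {} g) zt
      + of_nat (p (1 + m)) *
          ups_prod m \<Delta> (p 1) ((pd (1 + m) ^^ (p (1 + m) - 1)) (pd_prod m p {1 + m} g)) zt
      - (\<Sum>i\<in>{2..m}.
           of_nat (p i) * zt (i + m) *
             ups_prod m \<Delta> (p 1) ((pd i ^^ (p i - 1)) (pd_prod m p {i} g)) zt
           - of_nat (p (i + m)) * zt i *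
             ups_prod m \<Delta> (p 1) ((pd (i + m) ^^ (p (i + m) - 1)) (pd_prod m p {i + m} g)) zt))"

end

theory Submission
  imports Defs
begin

text \<open>By the Cauchy-Pompeiu formula the delta current in the wavefunction is a multiple of the
  evaluation at the insertion point \<open>z'\<close>, so multiplying it by a function that is regular there
  evaluates that function.  The contracted integrand of the charge has a simple pole at \<open>\<lambda>'\<close>, and
  its residue, evaluated at \<open>z'\<close>, is the Poisson bracket with the stated prefactor: the first two
  forms hold without any regular remainder.  On the patch \<open>z\<^sub>1 = 1\<close> the operators
  \<open>\<partial>\<^sub>a\<close> and \<open>\<Upsilon> + \<Delta> - 2\<close> raise the dimension of the wavefunction by one and
  multiply it by \<open>\<i> \<mu>\<^sup>a\<close> and \<open>- \<i> \<mu>\<^sup>1\<close>, so the celestial operator reproduces the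
  bracket, but with the current at \<open>z\<close> instead of \<open>z'\<close>.  The error is a difference quotient of the
  test function, which is bounded since test functions are Lipschitz.\<close>

section \<open>Continuously differentiable functions\<close>

text \<open>Multiplying a current by a function is a definite description over all test functions
  that represent the product near the support. For a point evaluation all representatives take the
  same value, but one has to exist, and the cut-off functions supply it. The coefficient produced by
  the Wick contraction, as a function of the point t of \<lambda>', is singular at the points of z
  and of o; the conditions that z differs from z' and that \<langle>z' o\<rangle> is nonzero keep it
  holomorphic near the support. The Cauchy-Pompeiu formula is reached without Stokes' theorem:
  integrals of derivatives vanish by translation invariance, and 1 / t is regularised. In the
  celestial formula every term with a nonzero exponent in front is a word of P - 1 operators, each
  raising the dimension by one. They lead from \<Delta> - P + 2 to \<Delta> + 1, where the
  \<mu>-derivatives of the wavefunction live. Each step uses the Gamma recursion, so no pole may be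
  met on the way; as the chain starts with Gamma (\<Delta> - P), this is the condition that \<Delta>
  - P is not a nonpositive integer.\<close>

definition C1_on :: "complex set \<Rightarrow> (complex \<Rightarrow> complex) \<Rightarrow> bool" where
  "C1_on S f \<longleftrightarrow> (\<forall>t\<in>S. f differentiable (at t)) \<and>
     (\<forall>v. continuous_on S (\<lambda>t. frechet_derivative f (at t) v))"

lemma test_fun_C1_on: "test_fun \<phi> \<longleftrightarrow> C1_on UNIV \<phi> \<and> bounded {t. \<phi> t \<noteq> 0}"
  by (auto simp: test_fun_def C1_on_def)

lemma C1_onI:
  assumes "\<And>t. t \<in> S \<Longrightarrow> (f has_derivative D t) (at t)"
    and "\<And>v. continuous_on S (\<lambda>t. D t v)"
  shows "C1_on S f"
proof -
  have "frechet_derivative f (at t) = D t" if "t \<in> S" for t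
    using frechet_derivative_at[OF assms(1)[OF that]] by simp
  then have "continuous_on S (\<lambda>t. frechet_derivative f (at t) v)" for v
    using assms(2)[of v] by (simp cong: continuous_on_cong)
  then show ?thesis
    using assms(1) unfolding C1_on_def differentiable_def by blast
qed

lemma C1_on_has_derivative:
  "C1_on S f \<Longrightarrow> t \<in> S \<Longrightarrow> (f has_derivative frechet_derivative f (at t)) (at t)"
  by (simp add: C1_on_def frechet_derivative_works)

lemma C1_on_continuous_derivative:
  "C1_on S f \<Longrightarrow> continuous_on S (\<lambda>t. frechet_derivative f (at t) v)"
  by (simp add: C1_on_def)

lemma C1_on_imp_continuous_on: "C1_on S f \<Longrightarrow> continuous_on S f"
  by (auto intro!: continuous_at_imp_continuous_on has_derivative_continuous[OF C1_on_has_derivative])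

lemma C1_on_subset: "C1_on S f \<Longrightarrow> T \<subseteq> S \<Longrightarrow> C1_on T f"
  unfolding C1_on_def by (auto intro: continuous_on_subset)

lemma C1_on_cong:
  assumes "open S" "\<And>t. t \<in> S \<Longrightarrow> f t = g t" "C1_on S f"
  shows "C1_on S g"
proof (rule C1_onI)
  show "(g has_derivative frechet_derivative f (at t)) (at t)" if "t \<in> S" for t
    using has_derivative_transform_within_open[OF C1_on_has_derivative[OF assms(3) that] assms(1) that] assms(2)
    by blast
  show "continuous_on S (\<lambda>t. frechet_derivative f (at t) v)" for v
    by (rule C1_on_continuous_derivative[OF assms(3)])
qed

lemma C1_on_Un:
  assumes "open S" "open T" "C1_on S f" "C1_on T f"
  shows "C1_on (S \<union> T) f"
  using assms unfolding C1_on_def by (auto intro!: continuous_on_open_Un)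

lemma C1_on_mult:
  assumes "C1_on S f" "C1_on S g"
  shows "C1_on S (\<lambda>t. f t * g t)"
proof (rule C1_onI)
  show "((\<lambda>t. f t * g t) has_derivative
      (\<lambda>v. f t * frechet_derivative g (at t) v + frechet_derivative f (at t) v * g t)) (at t)"
    if "t \<in> S" for t
    by (intro has_derivative_mult C1_on_has_derivative[OF _ that] assms)
  show "continuous_on S (\<lambda>t. f t * frechet_derivative g (at t) v + frechet_derivative f (at t) v * g t)"
    for v
    by (intro continuous_intros C1_on_imp_continuous_on C1_on_continuous_derivative assms)
qed

lemma frechet_derivative_mult:
  assumes "C1_on S f" "C1_on S g" "t \<in> S"
  shows "frechet_derivative (\<lambda>t. f t * g t) (at t) v =
      f t * frechet_derivative g (at t) v + frechet_derivative f (at t) v * g t"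
  by (subst frechet_derivative_at[OF has_derivative_mult[OF
      C1_on_has_derivative[OF assms(1,3)] C1_on_has_derivative[OF assms(2,3)]], symmetric]) simp

lemma dbar_fun_mult:
  assumes "C1_on S f" "C1_on S g" "t \<in> S"
  shows "dbar_fun (\<lambda>t. f t * g t) t = f t * dbar_fun g t + dbar_fun f t * g t"
  unfolding dbar_fun_def frechet_derivative_mult[OF assms] by (simp add: field_simps)

lemma holomorphic_imp_C1_on:
  assumes "f holomorphic_on S" "open S"
  shows "C1_on S f"
proof (rule C1_onI)
  show "(f has_derivative (\<lambda>v. deriv f t * v)) (at t)" if "t \<in> S" for t
    using holomorphic_derivI[OF assms that] by (simp add: has_field_derivative_def)
  show "continuous_on S (\<lambda>t. deriv f t * v)" for v
    by (intro continuous_intros holomorphic_on_imp_continuous_on holomorphic_deriv assms)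
qed

text \<open>Being C1 is a local property: on \<open>V\<close> the product is C1, on the complement
  of the closed support of \<open>\<beta>\<close> it is zero, and these two open sets cover the
  plane. The values of \<open>f\<close> outside \<open>V\<close> are irrelevant, so \<open>f\<close>
  may have poles there.\<close>

lemma test_fun_extend:
  assumes "open V" "C1_on V f" "C1_on UNIV \<beta>" "closure {t. \<beta> t \<noteq> 0} \<subseteq> V" "bounded {t. \<beta> t \<noteq> 0}"
  shows "test_fun (\<lambda>t. f t * \<beta> t)"
proof -
  let ?W = "- closure {t. \<beta> t \<noteq> 0}"
  have "C1_on V (\<lambda>t. f t * \<beta> t)"
    using assms by (intro C1_on_mult) (auto intro: C1_on_subset)
  moreover have "C1_on ?W (\<lambda>t. f t * \<beta> t)"
  proof (rule C1_on_cong)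
    show "C1_on ?W (\<lambda>t. 0)" by (rule C1_onI[where D = "\<lambda>_ _. 0"]) auto
    show "0 = f t * \<beta> t" if "t \<in> ?W" for t
      using that closure_subset[of "{t. \<beta> t \<noteq> 0}"] by auto
  qed auto
  ultimately have "C1_on (V \<union> ?W) (\<lambda>t. f t * \<beta> t)"
    using assms(1) by (intro C1_on_Un) auto
  moreover have "V \<union> ?W = UNIV" using assms(4) by auto
  moreover have "bounded {t. f t * \<beta> t \<noteq> 0}"
    by (rule bounded_subset[OF assms(5)]) auto
  ultimately show ?thesis by (simp add: test_fun_C1_on)
qed

text \<open>The squared positive part is C1 and vanishes on a half-line. Since test functions are
  only C1, it can replace the usual smooth function exp (- 1 / y) in the construction of
  cut-offs.\<close>

lemma DERIV_max_0_square: "((\<lambda>y::real. (max 0 y)\<^sup>2) has_real_derivative 2 * max 0 y) (at y)"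
proof -
  consider "y > 0" | "y < 0" | "y = 0" by linarith
  then show ?thesis
  proof cases
    case 1
    have "((\<lambda>y::real. y\<^sup>2) has_real_derivative 2 * max 0 y) (at y)"
      using 1 by (auto intro!: derivative_eq_intros)
    then show ?thesis
      by (rule has_field_derivative_transform_within_open[where S = "{0<..}"]) (use 1 in auto)
  next
    case 2
    have "((\<lambda>y::real. 0) has_real_derivative 2 * max 0 y) (at y)"
      using 2 by (auto intro!: derivative_eq_intros)
    then show ?thesis
      by (rule has_field_derivative_transform_within_open[where S = "{..<0}"]) (use 2 in auto)
  next
    case 3
    have "((\<lambda>h::real. (max 0 h)\<^sup>2 / h) \<longlongrightarrow> 0) (at 0)"
    proof (rule Lim_null_comparison)
      have "norm ((max 0 h)\<^sup>2 / h) \<le> \<bar>h\<bar>" for h :: real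
        by (cases "h > 0") (auto simp: power2_eq_square max_def)
      then show "\<forall>\<^sub>F h in at 0. norm ((max 0 h)\<^sup>2 / h) \<le> \<bar>h\<bar>" by simp
      show "((\<lambda>h::real. \<bar>h\<bar>) \<longlongrightarrow> 0) (at 0)" by (rule tendsto_eq_intros refl)+ simp
    qed
    then show ?thesis using 3 by (simp add: DERIV_def)
  qed
qed

lemma ex_bump:
  assumes "open U" "t0 \<in> U"
  obtains \<beta> :: "complex \<Rightarrow> complex" and V where
    "C1_on UNIV \<beta>" "closure {t. \<beta> t \<noteq> 0} \<subseteq> U" "bounded {t. \<beta> t \<noteq> 0}"
    "open V" "t0 \<in> V" "V \<subseteq> U" "\<And>t. t \<in> V \<Longrightarrow> \<beta> t = 1"
proof -
  obtain r where r: "r > 0" "cball t0 r \<subseteq> U"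
    using assms open_contains_cball_eq by blast
  define q where "q y = (max 0 y)\<^sup>2" for y :: real
  \<comment> \<open>With this constant \<open>g\<close> is -1 at the centre, 0 at distance r / sqrt
    2 and 1 at distance r. Hence \<open>\<beta>\<close> is 1 on the inner disc, where
    \<open>q (g t) = 0\<close>, and 0 from distance r on, where
    \<open>q (g t) \<ge> 1\<close>.\<close>
  define k where "k = 2 / r\<^sup>2"
  define g where "g t = k * ((t - t0) \<bullet> (t - t0)) - 1" for t
  define \<beta> where "\<beta> t = complex_of_real (q (1 - q (g t)))" for t
  have k: "k > 0" using r by (simp add: k_def)
  have q': "(q has_derivative (\<lambda>v. 2 * max 0 y * v)) (at y)" for y
    using DERIV_max_0_square[of y] unfolding q_def has_field_derivative_def by simp
  have g': "(g has_derivative (\<lambda>v. k * (2 * ((t - t0) \<bullet> v)))) (at t)" for t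
    unfolding g_def by (auto intro!: derivative_eq_intros simp: inner_commute)
  have "((\<lambda>t. 1 - q (g t)) has_derivative (\<lambda>v. 0 - 2 * max 0 (g t) * (k * (2 * ((t - t0) \<bullet> v))))) (at t)" for t
    by (intro has_derivative_diff has_derivative_const has_derivative_compose[OF g' q'])
  from has_derivative_of_real[OF has_derivative_compose[OF this q']]
  have "(\<beta> has_derivative (\<lambda>v. complex_of_real (2 * max 0 (1 - q (g t)) *
      (0 - 2 * max 0 (g t) * (k * (2 * ((t - t0) \<bullet> v))))))) (at t)" for t
    unfolding \<beta>_def by simp
  then have "C1_on UNIV \<beta>"
    by (rule C1_onI) (auto intro!: continuous_intros simp: q_def g_def)
  moreover have sub: "{t. \<beta> t \<noteq> 0} \<subseteq> cball t0 r"
  proof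
    fix t assume "t \<in> {t. \<beta> t \<noteq> 0}"
    then have "q (g t) < 1" by (auto simp: \<beta>_def q_def max_def split: if_splits)
    then have "g t < 1" by (auto simp: q_def max_def abs_square_less_1 split: if_splits)
    then have "k * (norm (t - t0))\<^sup>2 < 2" by (simp add: g_def power2_norm_eq_inner)
    then have "(norm (t - t0))\<^sup>2 < r\<^sup>2" using r by (simp add: k_def field_simps)
    then show "t \<in> cball t0 r"
      using r by (auto simp: dist_norm norm_minus_commute dest: power_less_imp_less_base)
  qed
  moreover have "closure {t. \<beta> t \<noteq> 0} \<subseteq> U"
    using closure_minimal[OF sub closed_cball] r(2) by blast
  moreover have "bounded {t. \<beta> t \<noteq> 0}" using sub bounded_cball bounded_subset by blast
  moreover define V where "V = U \<inter> {t. g t < 0}"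
  moreover have "open V" unfolding V_def g_def
    by (intro open_Int assms open_Collect_less continuous_intros)
  moreover have "t0 \<in> V" using assms by (simp add: V_def g_def)
  moreover have "\<beta> t = 1" if "t \<in> V" for t using that by (simp add: V_def \<beta>_def q_def)
  ultimately show ?thesis using that[of \<beta> V] by (auto simp: V_def)
qed

lemma ex_test_fun_eq_near:
  assumes "open V" "t0 \<in> V" "C1_on V f"
  obtains \<psi> U where "test_fun \<psi>" "closure {t. \<psi> t \<noteq> 0} \<subseteq> V" "open U" "t0 \<in> U"
    "\<And>t. t \<in> U \<Longrightarrow> \<psi> t = f t"
proof -
  obtain \<beta> U where \<beta>: "C1_on UNIV \<beta>" "closure {t. \<beta> t \<noteq> 0} \<subseteq> V" "bounded {t. \<beta> t \<noteq> 0}"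
    "open U" "t0 \<in> U" "U \<subseteq> V" "\<And>t. t \<in> U \<Longrightarrow> \<beta> t = 1"
    by (rule ex_bump[OF assms(1,2)]) blast
  show ?thesis
  proof
    show "test_fun (\<lambda>t. f t * \<beta> t)" by (rule test_fun_extend[OF assms(1,3) \<beta>(1-3)])
    show "closure {t. f t * \<beta> t \<noteq> 0} \<subseteq> V"
      using closure_mono[of "{t. f t * \<beta> t \<noteq> 0}" "{t. \<beta> t \<noteq> 0}"] \<beta>(2) by auto
  qed (use \<beta> in auto)
qed

section \<open>Point evaluations as currents\<close>

lemma cur_supp_point_evaluation:
  assumes "\<And>\<psi>. test_fun \<psi> \<Longrightarrow> T \<psi> = c * \<psi> t0"
  shows "cur_supp T = (if c = 0 then {} else {t0})"
proof (cases "c = 0")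
  case True
  then have "T \<psi> = 0" if "test_fun \<psi>" for \<psi> using assms[OF that] by simp
  then show ?thesis using True unfolding cur_supp_def by (auto dest!: spec[of _ UNIV])
next
  case False
  have "t0 \<in> cur_supp T" unfolding cur_supp_def
  proof clarify
    fix U assume U: "open U" "t0 \<in> U"
    have "C1_on U (\<lambda>_. 1)" by (intro holomorphic_imp_C1_on U) auto
    with U obtain \<psi> V where "test_fun \<psi>" "closure {t. \<psi> t \<noteq> 0} \<subseteq> U" "open V" "t0 \<in> V"
      "\<And>t. t \<in> V \<Longrightarrow> \<psi> t = 1" by (rule ex_test_fun_eq_near) blast
    then show "\<exists>\<phi>. test_fun \<phi> \<and> closure {x. \<phi> x \<noteq> 0} \<subseteq> U \<and> T \<phi> \<noteq> 0"
      using assms False by (intro exI[of _ \<psi>]) auto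
  qed
  moreover have "t \<notin> cur_supp T" if ne: "t \<noteq> t0" for t
  proof
    assume "t \<in> cur_supp T"
    then obtain \<phi> where "test_fun \<phi>" "closure {x. \<phi> x \<noteq> 0} \<subseteq> - {t0}" "T \<phi> \<noteq> 0"
      using ne unfolding cur_supp_def by (auto simp del: Compl_iff dest!: spec[of _ "- {t0}"])
    then show False using assms closure_subset[of "{x. \<phi> x \<noteq> 0}"] by auto
  qed
  ultimately show ?thesis using False by auto
qed

text \<open>A cut-off turns f \<phi> into a test function without changing it near
  \<open>t0\<close>, which gives a representative. If \<open>c \<noteq> 0\<close>, every
  representative agrees with f \<phi> at \<open>t0\<close>; if \<open>c = 0\<close>, the support is
  empty and the agreement condition may be void, but then T vanishes on all test functions
  anyway.\<close>

lemma mult_current_point_evaluation: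
  assumes T: "\<And>\<psi>. test_fun \<psi> \<Longrightarrow> T \<psi> = c * \<psi> t0"
    and f: "open V" "t0 \<in> V" "f holomorphic_on V" and \<phi>: "test_fun \<phi>"
  shows "mult_current f T \<phi> = c * (f t0 * \<phi> t0)"
proof -
  have "C1_on V (\<lambda>t. f t * \<phi> t)"
    by (rule C1_on_mult[OF holomorphic_imp_C1_on[OF f(3,1)]])
      (use \<phi> in \<open>auto simp: test_fun_C1_on intro: C1_on_subset\<close>)
  then obtain \<psi> U where \<psi>: "test_fun \<psi>" "open U" "t0 \<in> U" "\<And>t. t \<in> U \<Longrightarrow> \<psi> t = f t * \<phi> t"
    by (rule ex_test_fun_eq_near[OF f(1,2)]) blast
  have supp: "cur_supp T = (if c = 0 then {} else {t0})"
    using T by (rule cur_supp_point_evaluation)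
  show ?thesis
    unfolding mult_current_def supp
  proof (rule the_equality)
    show "\<exists>\<psi> U. test_fun \<psi> \<and> open U \<and> (if c = 0 then {} else {t0}) \<subseteq> U \<and>
        (\<forall>t\<in>U. \<psi> t = f t * \<phi> t) \<and> T \<psi> = c * (f t0 * \<phi> t0)"
      using \<psi> T by (intro exI[of _ \<psi>] exI[of _ U]) auto
  qed (auto simp: T split: if_splits)
qed

section \<open>The fundamental solution of the Cauchy-Riemann operator\<close>

lemma emeasure_lborel_norm_square_le:
  "emeasure lborel {t::complex. (norm t)\<^sup>2 \<le> r} = ennreal (pi * max 0 r)"
proof (cases "r < 0")
  case True
  then have "{t::complex. (norm t)\<^sup>2 \<le> r} = {}" by (auto simp: not_le intro: less_le_trans)
  then show ?thesis using True by simp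
next
  case False
  then have "{t::complex. (norm t)\<^sup>2 \<le> r} = cball 0 (sqrt r)"
    by (auto simp: real_le_rsqrt sqrt_ge_absD real_le_lsqrt power2_eq_square[symmetric] dest: sqrt_le_D)
  then show ?thesis
    using emeasure_cball[of "sqrt r" "0::complex"] False by (simp add: unit_ball_vol_2 max_def)
qed

text \<open>A substitute for polar coordinates: the area of a disc is linear in its squared radius,
  so the squared norm pushes area forward to a constant density on the half-line. The sets {..r}
  generate the Borel sets and suffice for the comparison.\<close>

lemma distr_lborel_norm_square:
  "distr lborel borel (\<lambda>t::complex. (norm t)\<^sup>2) =
    density lborel (\<lambda>r. ennreal pi * indicator {0..} r)" (is "?M = ?N")
proof (rule measure_eqI_generator_eq[where E = "range atMost" and \<Omega> = UNIV and A = "\<lambda>i. {..real i}"])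
  have M: "emeasure ?M {..r} = ennreal (pi * max 0 r)" for r
    by (subst emeasure_distr) (auto simp: vimage_def emeasure_lborel_norm_square_le)
  have "(\<integral>\<^sup>+x. ennreal pi * indicator {0..} x * indicator {..r} x \<partial>lborel) =
      ennreal (pi * max 0 r)" for r
  proof -
    have "(\<integral>\<^sup>+x. ennreal pi * indicator {0..} x * indicator {..r} x \<partial>lborel) =
        (\<integral>\<^sup>+x. ennreal pi * indicator {0..r} x \<partial>lborel)"
      by (intro nn_integral_cong) (auto simp: indicator_def)
    then show ?thesis
      by (cases "r < 0") (auto simp: nn_integral_cmult_indicator ennreal_mult max_def)
  qed
  then have N: "emeasure ?N {..r} = ennreal (pi * max 0 r)" for r
    by (subst emeasure_density) (auto simp: ac_simps)
  show "emeasure ?M X = emeasure ?N X" if "X \<in> range atMost" for X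
    using that M N by auto
  show "Int_stable (range (atMost :: real \<Rightarrow> real set))"
    by (auto simp: Int_stable_def)
  show "sets ?M = sigma_sets UNIV (range atMost)" "sets ?N = sigma_sets UNIV (range atMost)"
    by (simp_all add: borel_eq_atMost)
  show "\<Union> (range (\<lambda>i. {..real i})) = UNIV" by (auto simp: real_arch_simple)
  show "emeasure ?M {..real i} \<noteq> \<infinity>" for i using M by simp
qed auto

lemma nn_integral_radial:
  assumes [measurable]: "f \<in> borel_measurable (borel :: real measure)"
  shows "(\<integral>\<^sup>+t. f ((norm (t::complex))\<^sup>2) \<partial>lborel) = pi * (\<integral>\<^sup>+r. f r * indicator {0..} r \<partial>lborel)"
proof -
  have "(\<integral>\<^sup>+t. f ((norm (t::complex))\<^sup>2) \<partial>lborel) =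
      (\<integral>\<^sup>+r. f r \<partial>distr lborel borel (\<lambda>t::complex. (norm t)\<^sup>2))"
    by (rule nn_integral_distr[symmetric]) auto
  also have "\<dots> = (\<integral>\<^sup>+r. ennreal pi * (f r * indicator {0..} r) \<partial>lborel)"
    unfolding distr_lborel_norm_square by (subst nn_integral_density) (auto simp: ac_simps)
  finally show ?thesis by (simp add: nn_integral_cmult)
qed

text \<open>The radial formula reduces this to the integral of 1 / (1 + r)^2 over the half-line,
  which is 1. The integrand is the kernel of the approximate identity below at width 1.\<close>

lemma integral_fundamental_kernel:
  "has_bochner_integral lborel (\<lambda>t::complex. 1 / (1 + (norm t)\<^sup>2)\<^sup>2) pi"
proof (rule has_bochner_integral_nn_integral)
  have *: "((\<lambda>r. - 1 / (1 + r)) has_real_derivative 1 / (1 + r)\<^sup>2) (at r)" if "r \<ge> 0" for r :: real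
    using that by (auto intro!: derivative_eq_intros simp: power2_eq_square)
  have "((\<lambda>r. - 1 / (1 + r)) \<longlongrightarrow> (0::real)) at_top" by real_asymp
  then have "(\<integral>\<^sup>+r. ennreal (1 / (1 + r)\<^sup>2) * indicator {0..} r \<partial>lborel) = ennreal (0 - - 1 / (1 + 0))"
    by (intro nn_integral_FTC_atLeast *) auto
  then have "(\<integral>\<^sup>+r. ennreal (1 / (1 + r)\<^sup>2) * indicator {0..} r \<partial>lborel) = 1" by simp
  then show "(\<integral>\<^sup>+t. ennreal (1 / (1 + (norm (t::complex))\<^sup>2)\<^sup>2) \<partial>lborel) = ennreal pi"
    using nn_integral_radial[of "\<lambda>r. ennreal (1 / (1 + r)\<^sup>2)"] by simp
qed auto

text \<open>In the variable r = |t|^2 the singularity becomes r powr (-1/2), which is integrable at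
  0. This function dominates the regularised Cauchy kernels uniformly in their width.\<close>

lemma integrable_inverse_norm:
  "integrable lborel (\<lambda>t::complex. indicator (ball 0 R) t / norm t)"
proof (rule integrableI_nonneg)
  define f where "f r = ennreal (indicator {0..R\<^sup>2} r * (1 / sqrt r))" for r :: real
  have [measurable]: "f \<in> borel_measurable borel" unfolding f_def by measurable
  have "ennreal (indicator (ball 0 R) t / norm t) \<le> f ((norm t)\<^sup>2)" for t :: complex
  proof (cases "t \<in> ball 0 R")
    case True
    then have "(norm t)\<^sup>2 \<le> R\<^sup>2" by (intro power_mono) (auto simp: dist_norm)
    with True show ?thesis by (simp add: f_def)
  qed simp
  then have "(\<integral>\<^sup>+t. ennreal (indicator (ball 0 R) (t::complex) / norm t) \<partial>lborel) \<le>
      (\<integral>\<^sup>+t. f ((norm (t::complex))\<^sup>2) \<partial>lborel)"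
    by (intro nn_integral_mono)
  also have "\<dots> = pi * (\<integral>\<^sup>+r. f r * indicator {0..} r \<partial>lborel)"
    by (rule nn_integral_radial) fact
  also have "(\<integral>\<^sup>+r. f r * indicator {0..} r \<partial>lborel) =
      (\<integral>\<^sup>+r. ennreal (indicator {0..R\<^sup>2} r * r powr (-1/2)) \<partial>lborel)"
    by (intro nn_integral_cong)
      (auto simp: f_def indicator_def powr_minus_divide powr_half_sqrt)
  also have "\<dots> = ennreal ((R\<^sup>2) powr (-1/2+1) / (-1/2+1))"
  proof (rule nn_integral_has_integral_lebesgue)
    show "((\<lambda>r. r powr (-1/2)) has_integral (R\<^sup>2) powr (-1/2+1) / (-1/2+1)) {0..R\<^sup>2}"
      by (rule has_integral_powr_from_0) auto
  qed auto
  also have "ennreal pi * ennreal ((R\<^sup>2) powr (-1/2+1) / (-1/2+1)) < \<infinity>"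
    by (simp add: ennreal_mult_less_top)
  finally show "(\<integral>\<^sup>+t. ennreal (indicator (ball 0 R) (t::complex) / norm t) \<partial>lborel) < \<infinity>" .
  show "(\<lambda>t::complex. indicator (ball 0 R) t / norm t) \<in> borel_measurable lborel"
    by (simp add: borel_measurable_divide borel_measurable_indicator)
qed auto

section \<open>Integrals of compactly supported functions and of their derivatives\<close>

lemma integral_lborel_affine:
  fixes f :: "'a::euclidean_space \<Rightarrow> 'b::{banach, second_countable_topology}"
  assumes [measurable]: "f \<in> borel_measurable borel" and "c \<noteq> 0"
  shows "(LINT x|lborel. f x) = \<bar>c\<bar> ^ DIM('a) *\<^sub>R (LINT x|lborel. f (t + c *\<^sub>R x))"
  by (subst lborel_affine[OF \<open>c \<noteq> 0\<close>, of t]) (simp add: integral_density integral_distr)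

lemma integrable_continuous_bounded_support:
  fixes f :: "complex \<Rightarrow> complex"
  assumes "continuous_on UNIV f" "\<And>t. norm t \<ge> R \<Longrightarrow> f t = 0"
  shows "integrable lborel f"
proof -
  have "integrable lborel (\<lambda>t. indicator (cball 0 R) t *\<^sub>R f t)"
    using assms(1) by (intro borel_integrable_compact) (auto intro: continuous_on_subset)
  also have "(\<lambda>t. indicator (cball 0 R) t *\<^sub>R f t) = f"
    using assms(2) by (auto simp: fun_eq_iff indicator_def)
  finally show ?thesis .
qed

lemma bounded_of_bounded_support:
  fixes f :: "complex \<Rightarrow> complex"
  assumes "continuous_on UNIV f" "\<And>t. norm t \<ge> R \<Longrightarrow> f t = 0"
  obtains B where "B \<ge> 0" "\<And>t. norm (f t) \<le> B"
proof -
  have "bounded (f ` cball 0 R)"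
    using assms(1) by (intro compact_imp_bounded compact_continuous_image)
      (auto intro: continuous_on_subset)
  then obtain B where "\<And>t. t \<in> cball 0 R \<Longrightarrow> norm (f t) \<le> B"
    unfolding bounded_iff by blast
  then have "norm (f t) \<le> max B 0" for t
    using assms(2)[of t] by (cases "norm t \<le> R") (auto simp: le_max_iff_disj)
  then show ?thesis by (rule that[rotated]) simp
qed

lemma test_fun_support:
  assumes "test_fun \<phi>"
  obtains R where "R > 0" "\<And>t. norm t \<ge> R \<Longrightarrow> \<phi> t = 0"
    "\<And>t v. norm t \<ge> R \<Longrightarrow> frechet_derivative \<phi> (at t) v = 0"
proof -
  obtain R where "\<And>t. \<phi> t \<noteq> 0 \<Longrightarrow> norm t \<le> R"
    using assms by (auto simp: test_fun_def bounded_iff)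
  then have R: "\<phi> t = 0" if "norm t > R" for t using that by (meson not_le)
  show ?thesis
  \<comment> \<open>The extra 1 gives each such point a neighbourhood on which \<phi> vanishes, so
    that the derivative vanishes there too; \<open>max 0\<close> makes the radius positive.\<close>
  proof (rule that[of "max 0 R + 1"])
    fix t v :: complex assume t: "norm t \<ge> max 0 R + 1"
    then show "\<phi> t = 0" by (intro R) linarith
    have "(\<phi> has_derivative (\<lambda>_. 0)) (at t)"
    proof (rule has_derivative_transform_within_open[of "\<lambda>_. 0"])
      show "open {t::complex. norm t > R}" by (intro open_Collect_less continuous_intros)
    qed (use t R in auto)
    then show "frechet_derivative \<phi> (at t) v = 0"
      by (metis frechet_derivative_at)
  qed simp
qed

lemma test_fun_continuous: "test_fun \<phi> \<Longrightarrow> continuous_on UNIV \<phi>"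
  by (simp add: test_fun_C1_on C1_on_imp_continuous_on)

lemma test_fun_continuous_dbar: "test_fun \<phi> \<Longrightarrow> continuous_on UNIV (dbar_fun \<phi>)"
  unfolding dbar_fun_def
  by (intro continuous_intros C1_on_continuous_derivative) (auto simp: test_fun_C1_on)

text \<open>The derivative is only real-linear, so its operator norm is controlled by the values at
  1 and \<i>; both are continuous with bounded support, hence bounded. The constant serves twice: it
  dominates difference quotients in \<open>integral_frechet_derivative_eq_0\<close> and bounds the
  remainder of the celestial OPE.\<close>

lemma test_fun_lipschitz:
  assumes "test_fun \<psi>"
  obtains L where "L \<ge> 0" "\<And>x y. norm (\<psi> x - \<psi> y) \<le> L * norm (x - y)"
proof -
  let ?D = "\<lambda>t. frechet_derivative \<psi> (at t)"
  obtain R where R: "\<And>t v. norm t \<ge> R \<Longrightarrow> ?D t v = 0"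
    by (rule test_fun_support[OF assms]) blast
  have cont: "continuous_on UNIV (\<lambda>t. ?D t v)" for v
    using assms by (simp add: test_fun_C1_on C1_on_continuous_derivative)
  obtain A B where A: "A \<ge> 0" "\<And>t. norm (?D t 1) \<le> A" and B: "B \<ge> 0" "\<And>t. norm (?D t \<i>) \<le> B"
    using bounded_of_bounded_support[OF cont R] by metis
  have "norm (?D t v) \<le> (A + B) * norm v" for t v
  proof -
    have lin: "linear (?D t)" using assms by (auto simp: test_fun_def intro: linear_frechet_derivative)
    have "v = Re v *\<^sub>R 1 + Im v *\<^sub>R \<i>" by (simp add: complex_eq_iff)
    then have "?D t v = Re v *\<^sub>R ?D t 1 + Im v *\<^sub>R ?D t \<i>"
      using linear_add[OF lin] linear_scale[OF lin] by metis
    then have "norm (?D t v) \<le> norm (Re v *\<^sub>R ?D t 1) + norm (Im v *\<^sub>R ?D t \<i>)"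
      using norm_triangle_ineq by metis
    also have "\<dots> \<le> norm v * A + norm v * B"
      unfolding norm_scaleR using A B abs_Re_le_cmod abs_Im_le_cmod
      by (intro add_mono mult_mono) auto
    finally show ?thesis by (simp add: algebra_simps)
  qed
  then have "onorm (?D t) \<le> A + B" for t using A B by (intro onorm_bound) auto
  then have "norm (\<psi> x - \<psi> y) \<le> (A + B) * norm (x - y)" for x y
    using assms by (intro differentiable_bound[of UNIV \<psi> ?D])
      (auto simp: test_fun_C1_on C1_on_has_derivative)
  then show ?thesis using A B by (intro that[of "A + B"]) auto
qed

lemma test_fun_difference_quotient_tendsto:
  assumes "test_fun \<psi>"
  shows "(\<lambda>n. (\<psi> (t + (1 / Suc n) *\<^sub>R v) - \<psi> t) /\<^sub>R (1 / Suc n)) \<longlonglongrightarrow> frechet_derivative \<psi> (at t) v"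
proof -
  define g where "g x = \<psi> (t + x *\<^sub>R v)" for x :: real
  have lin: "linear (frechet_derivative \<psi> (at t))"
    using assms by (auto simp: test_fun_def intro: linear_frechet_derivative)
  have "(g has_derivative (\<lambda>x. frechet_derivative \<psi> (at (t + 0 *\<^sub>R v)) (x *\<^sub>R v))) (at 0)"
    unfolding g_def
    by (rule has_derivative_compose[OF _ C1_on_has_derivative])
      (use assms in \<open>auto simp: test_fun_C1_on intro!: derivative_eq_intros\<close>)
  then have "(g has_vector_derivative frechet_derivative \<psi> (at t) v) (at 0)"
    using lin by (simp add: has_vector_derivative_def linear_scale)
  then have "((\<lambda>x. (g x - g 0) /\<^sub>R x) \<longlongrightarrow> frechet_derivative \<psi> (at t) v) (at 0)"
  proof -
    let ?D = "frechet_derivative \<psi> (at t) v"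
    assume "(g has_vector_derivative ?D) (at 0)"
    then have "((\<lambda>x. norm (g x - g 0 - x *\<^sub>R ?D) / norm x) \<longlongrightarrow> 0) (at 0)"
      by (simp add: has_vector_derivative_def has_derivative_at)
    then have "((\<lambda>x. norm ((g x - g 0) /\<^sub>R x - ?D)) \<longlongrightarrow> 0) (at 0)"
    proof (rule Lim_transform_eventually)
      have "norm (g x - g 0 - x *\<^sub>R ?D) / norm x = norm ((g x - g 0) /\<^sub>R x - ?D)" if "x \<noteq> 0" for x
      proof -
        have "(g x - g 0) /\<^sub>R x - ?D = (g x - g 0 - x *\<^sub>R ?D) /\<^sub>R x"
          using that by (simp add: scaleR_diff_right)
        then show ?thesis by (simp add: divide_inverse mult.commute)
      qed
      then show "\<forall>\<^sub>F x in at 0. norm (g x - g 0 - x *\<^sub>R ?D) / norm x = norm ((g x - g 0) /\<^sub>R x - ?D)"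
        by (auto simp: eventually_at_filter)
    qed
    then show "((\<lambda>x. (g x - g 0) /\<^sub>R x) \<longlongrightarrow> ?D) (at 0)"
      by (rule LIM_zero_cancel[OF tendsto_norm_zero_cancel])
  qed
  then have "(\<lambda>n. (g (1 / Suc n) - g 0) /\<^sub>R (1 / Suc n)) \<longlonglongrightarrow> frechet_derivative \<psi> (at t) v"
  proof (rule filterlim_compose)
    show "filterlim (\<lambda>n. 1 / real (Suc n)) (at 0) sequentially"
      using LIMSEQ_Suc[OF lim_1_over_n[where 'a = real]] by (simp add: filterlim_at)
  qed
  then show ?thesis by (simp add: g_def)
qed

text \<open>By translation invariance of Lebesgue measure each difference quotient has integral
  zero, and dominated convergence carries this over to the derivative. All integration by parts
  below rests on this fact.\<close>

lemma integral_frechet_derivative_eq_0: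
  assumes "test_fun \<psi>"
  shows "(LINT t|lborel. frechet_derivative \<psi> (at t) v) = 0"
proof -
  obtain R where R: "R > 0" "\<And>t. norm t \<ge> R \<Longrightarrow> \<psi> t = 0"
    "\<And>t v. norm t \<ge> R \<Longrightarrow> frechet_derivative \<psi> (at t) v = 0"
    by (rule test_fun_support[OF assms]) blast
  have cont: "continuous_on UNIV \<psi>" "continuous_on UNIV (\<lambda>t. frechet_derivative \<psi> (at t) v)"
    using assms by (auto simp: test_fun_C1_on C1_on_imp_continuous_on C1_on_continuous_derivative)
  note [measurable] = borel_measurable_continuous_onI[OF cont(1)] borel_measurable_continuous_onI[OF cont(2)]
  obtain L where L: "L \<ge> 0" "\<And>x y. norm (\<psi> x - \<psi> y) \<le> L * norm (x - y)"
    using test_fun_lipschitz[OF assms] by blast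
  define B where "B = L * norm v"
  have B: "B \<ge> 0" using L by (simp add: B_def)
  define s where "s n t = (\<psi> (t + (1 / Suc n) *\<^sub>R v) - \<psi> t) /\<^sub>R (1 / Suc n)" for n t
  have "(\<lambda>n. LINT t|lborel. s n t) \<longlonglongrightarrow> (LINT t|lborel. frechet_derivative \<psi> (at t) v)"
  proof (rule integral_dominated_convergence)
    \<comment> \<open>The shifts have length at most \<open>norm v\<close>, so this one disc
      contains the supports of all difference quotients.\<close>
    show "integrable lborel (\<lambda>t::complex. B * indicator (cball 0 (R + norm v)) t)"
      by (intro integrable_mult_right integrable_real_indicator) (use emeasure_lborel_cball_finite[of "0::complex"] in auto)
    show "AE t in lborel. (\<lambda>n. s n t) \<longlonglongrightarrow> frechet_derivative \<psi> (at t) v"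
      unfolding s_def using test_fun_difference_quotient_tendsto[OF assms] by simp
    have "norm (s n t) \<le> B * indicator (cball 0 (R + norm v)) t" for n t
    proof (cases "norm t \<le> R + norm v")
      case True
      have "norm (s n t) = norm (\<psi> (t + (1 / Suc n) *\<^sub>R v) - \<psi> t) / (1 / Suc n)"
        unfolding s_def norm_scaleR by (simp only: divide_inverse mult.commute norm_inverse) simp
      also have "\<dots> \<le> B"
        using L(2)[of "t + (1 / Suc n) *\<^sub>R v" t]
        by (subst pos_divide_le_eq) (auto simp: B_def)
      finally show ?thesis using True by simp
    next
      case False
      have "norm ((1 / Suc n) *\<^sub>R v) \<le> norm v"
        using mult_left_le_one_le[of "norm v" "1 / Suc n"] by simp
      then have "norm (t + (1 / Suc n) *\<^sub>R v) \<ge> R" "norm t \<ge> R"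
        using False norm_ge_zero[of v] norm_diff_ineq[of t "(1 / Suc n) *\<^sub>R v"] by linarith+
      then have "s n t = 0" using R(2) by (simp add: s_def)
      then show ?thesis using B by simp
    qed
    then show "AE t in lborel. norm (s n t) \<le> B * indicator (cball 0 (R + norm v)) t" for n by simp
  qed (simp_all add: s_def)
  moreover have "(LINT t|lborel. s n t) = 0" for n
  proof -
    have int: "integrable lborel \<psi>" "integrable lborel (\<lambda>t. \<psi> (t + (1 / Suc n) *\<^sub>R v))"
    proof -
      show "integrable lborel \<psi>" by (rule integrable_continuous_bounded_support[OF cont(1) R(2)])
      show "integrable lborel (\<lambda>t. \<psi> (t + (1 / Suc n) *\<^sub>R v))"
      proof (rule integrable_continuous_bounded_support)
        show "continuous_on UNIV (\<lambda>t. \<psi> (t + (1 / Suc n) *\<^sub>R v))"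
          by (rule continuous_on_compose2[OF cont(1)]) (auto intro!: continuous_intros)
        fix t :: complex assume *: "R + norm ((1 / Suc n) *\<^sub>R v) \<le> norm t"
        then show "\<psi> (t + (1 / Suc n) *\<^sub>R v) = 0"
          using norm_diff_ineq[of t "(1 / Suc n) *\<^sub>R v"] by (intro R(2)) linarith
      qed
    qed
    have "(LINT t|lborel. \<psi> (t + (1 / Suc n) *\<^sub>R v)) = (LINT t|lborel. \<psi> t)"
      using integral_lborel_affine[of \<psi> 1 "(1 / Suc n) *\<^sub>R v"] by (simp add: add.commute)
    then show ?thesis unfolding s_def using int by simp
  qed
  ultimately show ?thesis by (simp add: LIMSEQ_const_iff)
qed

lemma integral_dbar_fun_eq_0:
  assumes "test_fun \<psi>"
  shows "(LINT t|lborel. dbar_fun \<psi> t) = 0"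
proof -
  obtain R where R: "\<And>t v. norm t \<ge> R \<Longrightarrow> frechet_derivative \<psi> (at t) v = 0"
    by (rule test_fun_support[OF assms]) blast
  have int: "integrable lborel (\<lambda>t. frechet_derivative \<psi> (at t) v)" for v
    using assms R
    by (intro integrable_continuous_bounded_support C1_on_continuous_derivative)
      (auto simp: test_fun_C1_on)
  show ?thesis
    unfolding dbar_fun_def using int by (simp add: integral_frechet_derivative_eq_0[OF assms])
qed

text \<open>\<open>cnj t / (\<bar>t\<bar>\<^sup>2 + e\<^sup>2)\<close> is a smooth approximation of \<open>1 / t\<close>, and its \<open>dbar\<close>-derivative
  is an approximate identity of mass \<open>pi\<close>.\<close>

definition cauchy_reg :: "real \<Rightarrow> complex \<Rightarrow> complex" where
  "cauchy_reg e t = cnj t * of_real (1 / ((norm t)\<^sup>2 + e\<^sup>2))"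

lemma cauchy_reg_has_derivative:
  assumes "e \<noteq> 0"
  shows "(cauchy_reg e has_derivative
    (\<lambda>v. cnj t * of_real (- (2 * (t \<bullet> v)) / ((norm t)\<^sup>2 + e\<^sup>2)\<^sup>2) +
       cnj v * of_real (1 / ((norm t)\<^sup>2 + e\<^sup>2)))) (at t)"
proof -
  have N: "(norm t)\<^sup>2 + e\<^sup>2 \<noteq> 0" using assms by (simp add: add_nonneg_eq_0_iff)
  have "((\<lambda>t. 1 / ((norm t)\<^sup>2 + e\<^sup>2)) has_derivative
      (\<lambda>v. - (2 * (t \<bullet> v)) / ((norm t)\<^sup>2 + e\<^sup>2)\<^sup>2)) (at t)"
    using N unfolding power2_norm_eq_inner
    by (auto intro!: derivative_eq_intros simp: inner_commute power2_eq_square divide_simps)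
  then show ?thesis
    unfolding cauchy_reg_def
    by (intro has_derivative_mult has_derivative_of_real bounded_linear.has_derivative[OF bounded_linear_cnj]) auto
qed

lemma C1_on_cauchy_reg:
  assumes "e \<noteq> 0"
  shows "C1_on UNIV (cauchy_reg e)"
  by (rule C1_onI[OF cauchy_reg_has_derivative[OF assms]], intro continuous_intros)
    (simp_all add: assms sum_power2_eq_zero_iff)

lemma dbar_fun_cauchy_reg:
  assumes "e \<noteq> 0"
  shows "dbar_fun (cauchy_reg e) t = of_real (e\<^sup>2 / ((norm t)\<^sup>2 + e\<^sup>2)\<^sup>2)"
proof -
  define N where "N = (norm t)\<^sup>2 + e\<^sup>2"
  have N: "N \<noteq> 0" using assms by (simp add: N_def add_nonneg_eq_0_iff)
  note D = frechet_derivative_at[OF cauchy_reg_has_derivative[OF assms], of t, symmetric]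
  have "dbar_fun (cauchy_reg e) t =
      of_real (1 / N) - cnj t * (Re t + \<i> * Im t) * of_real (1 / N\<^sup>2)"
    unfolding dbar_fun_def D N_def[symmetric] by (simp add: inner_complex_def field_simps) (simp add: add_divide_distrib)
  \<comment> \<open>With |t|^2 = N - e^2 the two terms 1 / N and |t|^2 / N^2 differ by exactly e^2 /
    N^2.\<close>
  also have "cnj t * (Re t + \<i> * Im t) = of_real (N - e\<^sup>2)"
    by (simp only: complex_eq[symmetric] complex_norm_square N_def add_diff_cancel_right' mult.commute)
  also have "of_real (1 / N) - of_real (N - e\<^sup>2) * of_real (1 / N\<^sup>2) = (of_real (e\<^sup>2 / N\<^sup>2) :: complex)"
    unfolding of_real_mult[symmetric] of_real_diff[symmetric] of_real_eq_iff
    using N by (simp add: field_simps power2_eq_square)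
  finally show ?thesis by (simp add: N_def)
qed

text \<open>Integration by parts: for \<open>e \<noteq> 0\<close> the kernel is C1 on the whole
  plane, so its product with \<phi> is a test function, whose dbar-derivative has integral zero by
  \<open>integral_dbar_fun_eq_0\<close>. With 1 / t in its place the product need not be
  differentiable at 0.\<close>

lemma integral_cauchy_reg:
  fixes \<phi> :: "complex \<Rightarrow> complex"
  assumes "test_fun \<phi>" "e \<noteq> 0"
  shows "(LINT t|lborel. cauchy_reg e t * dbar_fun \<phi> t) =
    - (LINT t|lborel. of_real (e\<^sup>2 / ((norm t)\<^sup>2 + e\<^sup>2)\<^sup>2) * \<phi> t)"
proof -
  have C1: "C1_on UNIV (cauchy_reg e)" "C1_on UNIV \<phi>"
    using assms C1_on_cauchy_reg by (auto simp: test_fun_C1_on)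
  obtain R where R: "\<And>t. norm t \<ge> R \<Longrightarrow> \<phi> t = 0"
    "\<And>t v. norm t \<ge> R \<Longrightarrow> frechet_derivative \<phi> (at t) v = 0"
    by (rule test_fun_support[OF assms(1)]) blast
  have int1: "integrable lborel (\<lambda>t. cauchy_reg e t * dbar_fun \<phi> t)"
  proof (rule integrable_continuous_bounded_support[where R = R])
    show "continuous_on UNIV (\<lambda>t. cauchy_reg e t * dbar_fun \<phi> t)"
      by (intro continuous_intros C1_on_imp_continuous_on C1 test_fun_continuous_dbar assms)
  qed (simp add: R dbar_fun_def)
  have int2: "integrable lborel (\<lambda>t. of_real (e\<^sup>2 / ((norm t)\<^sup>2 + e\<^sup>2)\<^sup>2) * \<phi> t)"
  proof (rule integrable_continuous_bounded_support[where R = R])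
    show "continuous_on UNIV (\<lambda>t. of_real (e\<^sup>2 / ((norm t)\<^sup>2 + e\<^sup>2)\<^sup>2) * \<phi> t)"
      by (intro continuous_intros test_fun_continuous assms) (simp_all add: assms sum_power2_eq_zero_iff)
  qed (use R in simp)
  have "test_fun (\<lambda>t. cauchy_reg e t * \<phi> t)"
    using assms C1_on_mult[OF C1]
    by (auto simp: test_fun_C1_on elim!: bounded_subset)
  then have "(LINT t|lborel. dbar_fun (\<lambda>t. cauchy_reg e t * \<phi> t) t) = 0"
    by (rule integral_dbar_fun_eq_0)
  also have "(LINT t|lborel. dbar_fun (\<lambda>t. cauchy_reg e t * \<phi> t) t) =
      (LINT t|lborel. cauchy_reg e t * dbar_fun \<phi> t + of_real (e\<^sup>2 / ((norm t)\<^sup>2 + e\<^sup>2)\<^sup>2) * \<phi> t)"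
    using dbar_fun_mult[OF C1] dbar_fun_cauchy_reg[OF assms(2)] by simp
  also have "\<dots> = (LINT t|lborel. cauchy_reg e t * dbar_fun \<phi> t) +
      (LINT t|lborel. of_real (e\<^sup>2 / ((norm t)\<^sup>2 + e\<^sup>2)\<^sup>2) * \<phi> t)"
    by (rule Bochner_Integration.integral_add[OF int1 int2])
  finally show ?thesis by (simp add: eq_neg_iff_add_eq_0)
qed

lemma integral_cauchy_reg_tendsto:
  fixes \<phi> :: "complex \<Rightarrow> complex"
  assumes "test_fun \<phi>"
  shows "(\<lambda>n. LINT t|lborel. cauchy_reg (1 / Suc n) t * dbar_fun \<phi> t)
    \<longlonglongrightarrow> (LINT t|lborel. 1 / t * dbar_fun \<phi> t)"
proof -
  obtain R where R: "R > 0" "\<And>t v. norm t \<ge> R \<Longrightarrow> frechet_derivative \<phi> (at t) v = 0"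
    by (rule test_fun_support[OF assms]) blast
  have dbar0: "dbar_fun \<phi> t = 0" if "norm t \<ge> R" for t using that R by (simp add: dbar_fun_def)
  note cont = test_fun_continuous_dbar[OF assms]
  obtain B where B: "B \<ge> 0" "\<And>t. norm (dbar_fun \<phi> t) \<le> B"
    using bounded_of_bounded_support[OF cont dbar0] by blast
  note [measurable] = borel_measurable_continuous_onI[OF cont]
  have [measurable]: "cauchy_reg (1 / Suc n) \<in> borel_measurable borel" for n
    by (intro borel_measurable_continuous_onI C1_on_imp_continuous_on C1_on_cauchy_reg) simp
  show ?thesis
  proof (rule integral_dominated_convergence)
    show "integrable lborel (\<lambda>t::complex. B * (indicator (ball 0 R) t / norm t))"
      by (intro integrable_mult_right integrable_inverse_norm)
    have lim: "(\<lambda>n. cauchy_reg (1 / Suc n) t) \<longlonglongrightarrow> 1 / t" for t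
    \<comment> \<open>At the origin the kernels are 0 and the limit 1 / 0 is 0 by convention, so
      convergence holds at every point and not only almost everywhere.\<close>
    proof (cases "t = 0")
      case False
      have "(\<lambda>n. 1 / ((norm t)\<^sup>2 + (1 / Suc n)\<^sup>2)) \<longlonglongrightarrow> 1 / ((norm t)\<^sup>2 + 0\<^sup>2)"
        using False by (intro tendsto_intros LIMSEQ_Suc[OF lim_1_over_n]) auto
      then have "(\<lambda>n. cauchy_reg (1 / Suc n) t) \<longlonglongrightarrow> cnj t * of_real (1 / ((norm t)\<^sup>2 + 0\<^sup>2))"
        unfolding cauchy_reg_def by (rule tendsto_mult[OF tendsto_const tendsto_of_real])
      also have "cnj t * of_real (1 / ((norm t)\<^sup>2 + 0\<^sup>2)) = 1 / t"
        using False by (simp add: complex_norm_square[symmetric] field_simps)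
      finally show ?thesis .
    qed (simp add: cauchy_reg_def)
    show "AE t in lborel. (\<lambda>n. cauchy_reg (1 / Suc n) t * dbar_fun \<phi> t) \<longlonglongrightarrow> 1 / t * dbar_fun \<phi> t"
      by (intro AE_I2 tendsto_mult tendsto_const lim)
    have "norm (cauchy_reg e t * dbar_fun \<phi> t) \<le> B * (indicator (ball 0 R) t / norm t)" for t e
    proof (cases "norm t < R \<and> t \<noteq> 0")
      case True
      then have "\<bar>1 / ((norm t)\<^sup>2 + e\<^sup>2)\<bar> \<le> 1 / (norm t)\<^sup>2"
        by (subst abs_of_nonneg) (auto intro!: divide_left_mono mult_pos_pos add_pos_nonneg)
      then have "norm (cauchy_reg e t) \<le> norm t * (1 / (norm t)\<^sup>2)"
        unfolding cauchy_reg_def norm_mult norm_of_real complex_mod_cnj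
        by (intro mult_left_mono) auto
      also have "\<dots> = 1 / norm t" by (simp add: power2_eq_square)
      finally have "norm (cauchy_reg e t) * norm (dbar_fun \<phi> t) \<le> 1 / norm t * B"
        using B by (intro mult_mono) auto
      then show ?thesis using True by (simp add: norm_mult)
    next
      case False
      then show ?thesis using dbar0[of t] by (auto simp: cauchy_reg_def)
    qed
    then show "AE t in lborel. norm (cauchy_reg (1 / Suc n) t * dbar_fun \<phi> t)
        \<le> B * (indicator (ball 0 R) t / norm t)" for n
      by simp
  qed measurable
qed

text \<open>The dilation t \<mapsto> e t has Jacobian e^2 in the plane, which removes e from the
  kernel and moves it into the argument of \<phi>. What remains is a fixed integrable kernel times
  \<phi> (e t), which tends to \<phi> 0 boundedly.\<close>

lemma integral_approximate_identity_tendsto: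
  fixes \<phi> :: "complex \<Rightarrow> complex"
  assumes "test_fun \<phi>"
  shows "(\<lambda>n. LINT t|lborel. of_real ((1 / Suc n)\<^sup>2 / ((norm t)\<^sup>2 + (1 / Suc n)\<^sup>2)\<^sup>2) * \<phi> t)
    \<longlonglongrightarrow> pi * \<phi> 0"
proof -
  obtain R where R: "\<And>t. norm t \<ge> R \<Longrightarrow> \<phi> t = 0"
    by (rule test_fun_support[OF assms]) blast
  note cont = test_fun_continuous[OF assms]
  obtain B where B: "B \<ge> 0" "\<And>t. norm (\<phi> t) \<le> B"
    using bounded_of_bounded_support[OF cont R] by blast
  note [measurable] = borel_measurable_continuous_onI[OF cont]
  define k where "k t = 1 / (1 + (norm t)\<^sup>2)\<^sup>2" for t :: complex
  have k: "has_bochner_integral lborel k pi"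
    unfolding k_def by (rule integral_fundamental_kernel)
  have [measurable]: "k \<in> borel_measurable borel" unfolding k_def by measurable
  have scaled: "(LINT t|lborel. of_real (e\<^sup>2 / ((norm t)\<^sup>2 + e\<^sup>2)\<^sup>2) * \<phi> t) =
      (LINT t|lborel. of_real (k t) * \<phi> (e *\<^sub>R t))" if "e > 0" for e
  proof -
    have eq: "e\<^sup>2 * (e\<^sup>2 / ((norm (e *\<^sub>R t))\<^sup>2 + e\<^sup>2)\<^sup>2) = k t" for t :: complex
    proof -
      have "(norm (e *\<^sub>R t))\<^sup>2 + e\<^sup>2 = e\<^sup>2 * (1 + (norm t)\<^sup>2)"
        by (simp add: power_mult_distrib algebra_simps)
      then show ?thesis using that by (simp add: k_def power_mult_distrib power2_eq_square)
    qed
    have "(LINT t|lborel. of_real (e\<^sup>2 / ((norm t)\<^sup>2 + e\<^sup>2)\<^sup>2) * \<phi> t) =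
        e\<^sup>2 *\<^sub>R (LINT t|lborel. of_real (e\<^sup>2 / ((norm (e *\<^sub>R t))\<^sup>2 + e\<^sup>2)\<^sup>2) * \<phi> (e *\<^sub>R t))"
      using that by (subst integral_lborel_affine[of _ e 0]) auto
    also have "\<dots> = (LINT t|lborel. of_real (e\<^sup>2 * (e\<^sup>2 / ((norm (e *\<^sub>R t))\<^sup>2 + e\<^sup>2)\<^sup>2)) * \<phi> (e *\<^sub>R t))"
      by (simp only: of_real_mult scaleR_conv_of_real mult.assoc flip: integral_mult_right_zero)
    finally show ?thesis by (simp only: eq)
  qed
  have "(\<lambda>n. LINT t|lborel. of_real ((1 / Suc n)\<^sup>2 / ((norm t)\<^sup>2 + (1 / Suc n)\<^sup>2)\<^sup>2) * \<phi> t) =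
      (\<lambda>n. LINT t|lborel. of_real (k t) * \<phi> ((1 / Suc n) *\<^sub>R t))"
    by (intro ext scaled) simp
  also have "\<dots> \<longlonglongrightarrow> (LINT t|lborel. of_real (k t) * \<phi> (0 *\<^sub>R t))"
  proof (rule integral_dominated_convergence)
    show "integrable lborel (\<lambda>t. B * k t)"
      using k by (auto simp: has_bochner_integral_iff)
    show "AE t in lborel. (\<lambda>n. of_real (k t) * \<phi> ((1 / Suc n) *\<^sub>R t)) \<longlonglongrightarrow> of_real (k t) * \<phi> (0 *\<^sub>R t)"
    proof (rule AE_I2, intro tendsto_intros)
      fix t :: complex
      have "isCont \<phi> (0 *\<^sub>R t)" using cont by (simp add: continuous_on_eq_continuous_at)
      moreover have "(\<lambda>n. (1 / Suc n) *\<^sub>R t) \<longlonglongrightarrow> 0 *\<^sub>R t"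
        by (intro tendsto_intros LIMSEQ_Suc[OF lim_1_over_n])
      ultimately show "(\<lambda>n. \<phi> ((1 / Suc n) *\<^sub>R t)) \<longlonglongrightarrow> \<phi> (0 *\<^sub>R t)"
        by (rule isCont_tendsto_compose)
    qed
    have k0: "k t \<ge> 0" for t by (simp add: k_def)
    have "norm (of_real (k t) * \<phi> x) \<le> B * k t" for t x
      using mult_left_mono[OF B(2)[of x] k0[of t]]
      by (simp only: norm_mult norm_of_real abs_of_nonneg[OF k0] mult.commute)
    then show "AE t in lborel. norm (of_real (k t) * \<phi> ((1 / Suc n) *\<^sub>R t)) \<le> B * k t" for n
      by (intro AE_I2)
  qed measurable
  also have "(LINT t|lborel. of_real (k t) * \<phi> (0 *\<^sub>R t)) = pi * \<phi> 0"
    using k has_bochner_integral_of_real[OF k, where ?'a = complex]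
    by (simp add: has_bochner_integral_iff)
  finally show ?thesis .
qed

section \<open>The Cauchy-Pompeiu formula\<close>

lemma cauchy_pompeiu_0:
  fixes \<phi> :: "complex \<Rightarrow> complex"
  assumes "test_fun \<phi>"
  shows "(LINT t|lborel. 1 / t * dbar_fun \<phi> t) = - (pi * \<phi> 0)"
proof (rule LIMSEQ_unique[OF integral_cauchy_reg_tendsto[OF assms]])
  show "(\<lambda>n. LINT t|lborel. cauchy_reg (1 / Suc n) t * dbar_fun \<phi> t) \<longlonglongrightarrow> - (pi * \<phi> 0)"
    using tendsto_minus[OF integral_approximate_identity_tendsto[OF assms]]
    by (simp add: integral_cauchy_reg[OF assms])
qed

lemma dbar_cauchy_kernel:
  fixes \<phi> :: "complex \<Rightarrow> complex"
  assumes "test_fun \<phi>"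
  shows "dbar (\<lambda>t. 1 / (t - w)) \<phi> = pi * \<phi> w"
proof -
  define \<psi> where "\<psi> t = \<phi> (t + w)" for t
  have "(\<psi> has_derivative frechet_derivative \<phi> (at (t + w))) (at t)" for t
    unfolding \<psi>_def using assms
    by (intro has_derivative_compose[OF _ C1_on_has_derivative, of "\<lambda>t. t + w" "\<lambda>v. v" t UNIV UNIV])
      (auto simp: test_fun_C1_on intro!: derivative_eq_intros)
  note deriv = this
  have "C1_on UNIV \<psi>"
  proof (rule C1_onI[OF deriv])
    show "continuous_on UNIV (\<lambda>t. frechet_derivative \<phi> (at (t + w)) v)" for v
      using assms
      by (intro continuous_on_compose2[OF C1_on_continuous_derivative[of UNIV \<phi>]])
        (auto simp: test_fun_C1_on intro!: continuous_intros)
  qed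
  moreover have "bounded {t. \<psi> t \<noteq> 0}"
  proof -
    have "{t. \<psi> t \<noteq> 0} = (\<lambda>t. t - w) ` {t. \<phi> t \<noteq> 0}"
      by (auto simp: \<psi>_def image_iff intro!: exI[of _ "_ + w"])
    then show ?thesis using assms by (simp add: test_fun_def bounded_translation_minus)
  qed
  ultimately have \<psi>: "test_fun \<psi>" by (simp add: test_fun_C1_on)
  have eq: "dbar_fun \<psi> t = dbar_fun \<phi> (t + w)" for t
    unfolding dbar_fun_def frechet_derivative_at[OF deriv, symmetric] ..
  note [measurable] = borel_measurable_continuous_onI[OF test_fun_continuous_dbar[OF assms]]
  have "(LINT t|lborel. 1 / (t - w) * dbar_fun \<phi> t) = (LINT t|lborel. 1 / t * dbar_fun \<psi> t)"
    by (subst integral_lborel_affine[of _ 1 w]) (auto simp: eq add.commute)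
  then show ?thesis
    using cauchy_pompeiu_0[OF \<psi>] by (simp add: dbar_def \<psi>_def)
qed

section \<open>Conformal primary wavefunctions as point evaluations\<close>

text \<open>Along the section \<langle>\<iota> \<lambda>\<rangle> is the constant s, so the complex
  power does not depend on t and multiplies the current as a constant. The denominator combines 2
  \<pi> \<i> with the \<pi> of the Cauchy kernel and the factor \<open>s * fst z\<close> by which
  \<langle>\<lambda> z\<rangle> differs from \<open>t - aff_coord z\<close>.\<close>

lemma delta_bar_eq:
  assumes "s \<noteq> 0" "fst z \<noteq> 0" "test_fun \<phi>"
  shows "delta_bar \<Delta> s z \<phi> = (s / fst z) powr (\<Delta> + 1) / (2 * \<i> * s * fst z) * \<phi> (aff_coord z)"
proof -
  have eq: "1 / angle (sect s t) z = 1 / (s * fst z) * (1 / (t - aff_coord z))" for t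
    using assms by (simp add: angle_def sect_def aff_coord_def field_simps)
  have "1 / (2 * pi * \<i>) * dbar (\<lambda>t. 1 / angle (sect s t) z) \<psi> =
      1 / (2 * \<i> * s * fst z) * \<psi> (aff_coord z)" if "test_fun \<psi>" for \<psi>
  proof -
    have "dbar (\<lambda>t. 1 / angle (sect s t) z) \<psi> = 1 / (s * fst z) * dbar (\<lambda>t. 1 / (t - aff_coord z)) \<psi>"
      unfolding dbar_def eq by (simp only: mult.assoc integral_mult_right_zero mult_minus_right)
    then show ?thesis
      unfolding dbar_cauchy_kernel[OF that] using assms(1,2) by (simp add: field_simps)
  qed
  then have "delta_bar \<Delta> s z \<phi> = 1 / (2 * \<i> * s * fst z) *
      ((angle iota (sect s (aff_coord z)) / angle iota z) powr (\<Delta> + 1) * \<phi> (aff_coord z))"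
    unfolding delta_bar_def using assms(3)
    by (intro mult_current_point_evaluation[where V = UNIV]) (auto simp: angle_def iota_def sect_def)
  then show ?thesis by (simp add: angle_def iota_def sect_def)
qed

text \<open>The part of the wavefunction that depends on x = [\<mu> zt]. The delta-function factor
  involves neither \<mu> nor zt, so all derivatives in these variables act on this scalar
  function.\<close>

definition mellin_factor :: "complex \<Rightarrow> complex \<Rightarrow> complex" where
  "mellin_factor \<Delta> x = (- \<i>) powr (- \<Delta>) * Gamma (\<Delta> - 2) / x powr (\<Delta> - 2)"

lemma cpw_eq:
  assumes "s \<noteq> 0" "fst z \<noteq> 0" "test_fun \<phi>"
  shows "cpw m \<Delta> s z zt \<mu> \<phi> = mellin_factor \<Delta> (sq m \<mu> zt) *
    ((s / fst z) powr (\<Delta> + 1) / (2 * \<i> * s * fst z) * \<phi> (aff_coord z))"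
  by (simp add: cpw_def mellin_factor_def delta_bar_eq[OF assms])

text \<open>Raising \<Delta> by one multiplies the phase by \<i>, the Gamma factor by \<Delta> - 2
  and the power of x by 1 / x; together with the prefactor \<open>\<i> * x\<close> this gives
  -(\<Delta> - 2).\<close>

lemma mellin_factor_recursion:
  assumes "x \<noteq> 0" "\<Delta> - 2 \<notin> \<int>\<^sub>\<le>\<^sub>0"
  shows "\<i> * x * mellin_factor (\<Delta> + 1) x = - (\<Delta> - 2) * mellin_factor \<Delta> x"
proof -
  have I: "(- \<i>) powr (- \<Delta>) = (- \<i>) powr (- (\<Delta> + 1)) * (- \<i>)"
    using powr_add[of "- \<i>" "- (\<Delta> + 1)" 1] by (simp add: algebra_simps)
  have G: "Gamma (\<Delta> + 1 - 2) = (\<Delta> - 2) * Gamma (\<Delta> - 2)"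
    using Gamma_plus1[OF assms(2)] by (simp add: algebra_simps)
  have X: "x powr (\<Delta> + 1 - 2) = x powr (\<Delta> - 2) * x"
    using powr_add[of x "\<Delta> - 2" 1] assms(1) by (simp add: algebra_simps)
  show ?thesis unfolding mellin_factor_def I G X using assms(1) by (simp add: field_simps)
qed

text \<open>Differentiating the power gives -(\<Delta> - 2) / x, which the recursion turns into a
  shift of dimension. It mirrors the momentum eigenstate exp (\<i> \<omega> x), where d/dx brings
  down \<i> \<omega> and so raises the Mellin exponent by one.\<close>

lemma mellin_factor_has_field_derivative:
  assumes "x \<notin> \<real>\<^sub>\<le>\<^sub>0" "\<Delta> - 2 \<notin> \<int>\<^sub>\<le>\<^sub>0"
  shows "(mellin_factor \<Delta> has_field_derivative \<i> * mellin_factor (\<Delta> + 1) x) (at x)"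
proof -
  have x: "x \<noteq> 0" using assms(1) by auto
  have eq: "mellin_factor \<Delta> = (\<lambda>x. (- \<i>) powr (- \<Delta>) * Gamma (\<Delta> - 2) * x powr (- (\<Delta> - 2)))"
    by (simp add: mellin_factor_def fun_eq_iff powr_minus divide_inverse flip: powr_minus)
  have "(mellin_factor \<Delta> has_field_derivative
      (- \<i>) powr (- \<Delta>) * Gamma (\<Delta> - 2) * (- (\<Delta> - 2) * x powr (- (\<Delta> - 2) - 1))) (at x)"
    unfolding eq using assms(1) by (auto intro!: derivative_eq_intros)
  also have "x powr (- (\<Delta> - 2) - 1) = x powr (- (\<Delta> - 2)) / x"
    by (subst powr_diff) (use x in simp)
  also have "(- \<i>) powr (- \<Delta>) * Gamma (\<Delta> - 2) * (- (\<Delta> - 2) * (x powr (- (\<Delta> - 2)) / x)) =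
      - (\<Delta> - 2) * mellin_factor \<Delta> x / x"
    unfolding eq by (simp only: times_divide_eq_right mult_ac)
  also have "\<dots> = \<i> * mellin_factor (\<Delta> + 1) x"
    unfolding mellin_factor_recursion[OF x assms(2), symmetric] using x by simp
  finally show ?thesis .
qed

section \<open>Partial derivatives of the wavefunction\<close>

lemma sq_fun_upd_left:
  assumes "b \<in> {1..2 * m}"
  shows "sq m (\<mu>(b := u)) zt = sq m \<mu> zt + (u - \<mu> b) * zt b"
proof -
  have "sq m (\<mu>(b := u)) zt = (\<Sum>a\<in>{1..2 * m}. \<mu> a * zt a + (if a = b then (u - \<mu> b) * zt b else 0))"
    unfolding sq_def by (intro sum.cong) (auto simp: algebra_simps)
  then show ?thesis using assms by (simp add: sum.distrib sq_def)
qed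

lemma sq_commute: "sq m \<mu> zt = sq m zt \<mu>"
  by (simp add: sq_def mult.commute)

lemma pd_eqI:
  "((\<lambda>u. f (x(a := u))) has_field_derivative D) (at (x a)) \<Longrightarrow> pd a f x = D"
  by (simp add: pd_def DERIV_imp_deriv)

text \<open>The pairing is affine in each coordinate, so this is the chain rule. Since the pairing
  is symmetric, the same lemma with \<mu> and zt exchanged gives the derivatives in zt.\<close>

lemma pd_mellin_factor_mu:
  assumes "b \<in> {1..2 * m}" "sq m \<mu> zt \<notin> \<real>\<^sub>\<le>\<^sub>0" "\<Delta> - 2 \<notin> \<int>\<^sub>\<le>\<^sub>0"
  shows "pd b (\<lambda>\<nu>. mellin_factor \<Delta> (sq m \<nu> zt) * c) \<mu> = \<i> * zt b * mellin_factor (\<Delta> + 1) (sq m \<mu> zt) * c"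
proof (rule pd_eqI)
  have "((\<lambda>u. mellin_factor \<Delta> (sq m \<mu> zt + (u - \<mu> b) * zt b)) has_field_derivative
      \<i> * mellin_factor (\<Delta> + 1) (sq m \<mu> zt) * zt b) (at (\<mu> b))"
    by (rule DERIV_chain2[where g = "\<lambda>u. sq m \<mu> zt + (u - \<mu> b) * zt b"])
      (use mellin_factor_has_field_derivative[OF assms(2,3)] in \<open>auto intro!: derivative_eq_intros\<close>)
  then show "((\<lambda>u. mellin_factor \<Delta> (sq m (\<mu>(b := u)) zt) * c) has_field_derivative
      \<i> * zt b * mellin_factor (\<Delta> + 1) (sq m \<mu> zt) * c) (at (\<mu> b))"
    unfolding sq_fun_upd_left[OF assms(1)]
    by (rule DERIV_cong[OF DERIV_cmult_right]) (simp add: mult_ac)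
qed

section \<open>The action of the charge\<close>

lemma pd_wmon:
  assumes "a \<in> {1..2 * m}"
  shows "pd a (wmon m p) x = of_nat (p a) * x a ^ (p a - 1) * (\<Prod>c\<in>{1..2 * m} - {a}. x c ^ p c)"
proof (rule pd_eqI)
  have "wmon m p (x(a := u)) = u ^ p a * (\<Prod>c\<in>{1..2 * m} - {a}. x c ^ p c)" for u
    unfolding wmon_def using assms by (subst prod.remove[of _ a]) (auto intro!: prod.cong)
  then show "((\<lambda>u. wmon m p (x(a := u))) has_field_derivative
      of_nat (p a) * x a ^ (p a - 1) * (\<Prod>c\<in>{1..2 * m} - {a}. x c ^ p c)) (at (x a))"
    by (auto intro!: derivative_eq_intros)
qed

text \<open>The derivative of the monomial is homogeneous of degree P - 1, so rescaling by 1 / s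
  costs s^(P - 1); the extra s on the left makes it s^(2 - P). If \<open>p a = 0\<close>, both sides
  vanish.\<close>

lemma pd_wmon_scale:
  assumes "a \<in> {1..2 * m}" "s \<noteq> 0" "\<And>c. c \<in> {1..2 * m} \<Longrightarrow> y c = \<mu> c / s"
  shows "s * pd a (wmon m p) y = s powi (2 - int (wt m p)) * pd a (wmon m p) \<mu>"
proof (cases "p a = 0")
  case False
  have "(\<Prod>c\<in>{1..2 * m} - {a}. y c ^ p c) = (\<Prod>c\<in>{1..2 * m} - {a}. \<mu> c ^ p c / s ^ p c)"
    using assms(3) by (intro prod.cong) (auto simp: power_divide)
  also have "\<dots> = (\<Prod>c\<in>{1..2 * m} - {a}. \<mu> c ^ p c) / s ^ (\<Sum>c\<in>{1..2 * m} - {a}. p c)"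
    by (simp add: prod_dividef power_sum)
  finally have *: "(\<Prod>c\<in>{1..2 * m} - {a}. y c ^ p c) =
      (\<Prod>c\<in>{1..2 * m} - {a}. \<mu> c ^ p c) / s ^ (\<Sum>c\<in>{1..2 * m} - {a}. p c)" .
  have wt: "wt m p = Suc ((p a - 1) + (\<Sum>c\<in>{1..2 * m} - {a}. p c))"
    using False assms(1) unfolding wt_def by (subst sum.remove[of _ a]) auto
  have "s powi (2 - int (wt m p)) = s / s ^ ((p a - 1) + (\<Sum>c\<in>{1..2 * m} - {a}. p c))"
    (is "_ = s / s ^ ?N")
  proof -
    have "2 - int (wt m p) = 1 - int ?N" unfolding wt by simp
    moreover have "s powi (1 - int ?N) = s powi 1 / s powi int ?N"
      by (rule power_int_diff) (simp add: assms(2))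
    ultimately show ?thesis by (simp only: power_int_of_nat power_int_1_right)
  qed
  then show ?thesis
    unfolding pd_wmon[OF assms(1)] * assms(3)[OF assms(1)] by (simp add: power_divide power_add)
qed (use assms in \<open>simp add: pd_wmon\<close>)

text \<open>Of the pole structure at \<lambda> = \<lambda>' only the simple pole of the OPE is
  present: the field is holomorphic there, and z and o lie elsewhere. The residue is therefore the
  regular cofactor at t, where homogeneity of the field turns its value into \<mu> / s.\<close>

lemma contour_charge_contraction:
  fixes m osp p z s t X \<mu>
  defines "Y \<equiv> X (sect s t)"
  assumes "field_through m Y \<mu> (sect s t)" "s \<noteq> 0" "fst osp = 1" "t \<noteq> snd osp"
    "t * fst z - snd z \<noteq> 0" "fst z \<noteq> 0"
  shows "contour_charge m osp p z
      (\<lambda>l. \<Sum>a\<in>{1..2 * m}. pd a (wmon m p) (X (sect s t) l) * mu_ope m osp a b l (sect s t)) t =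
    - (\<i> powi (int (wt m p) - 2) * s powi (2 - int (wt m p)) *
      (\<Sum>a\<in>{1..2 * m}. eps m a b * pd a (wmon m p) \<mu>) /
      ((t * fst z - snd z) * fst z powi (3 - int (wt m p))))"
proof -
  define A where "A = {1..2 * m}"
  \<comment> \<open>The integrand times \<tau> - t. The factors of the OPE at o cancel one power of
    the double pole of the measure; what is left, \<open>(snd osp - t) / (\<tau> - snd osp)\<close>,
    equals -1 at \<tau> = t and is the source of the overall minus sign.\<close>
  define h where "h \<tau> = (\<Sum>a\<in>A. eps m a b * (s * pd a (wmon m p) (Y (sect 1 \<tau>)))) *
      (snd osp - t) / ((\<tau> * fst z - snd z) * fst z powi (3 - int (wt m p)) * (\<tau> - snd osp))" for \<tau>
  have "aff_coord (sect s t) = t" using assms by (simp add: aff_coord_def sect_def)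
  then have Y: "(\<lambda>\<tau>. Y (sect 1 \<tau>) c) analytic_on {t}" if "c \<in> A" for c
    using assms(2) that by (auto simp: field_through_def A_def)
  have pd: "(\<lambda>\<tau>. pd a (wmon m p) (Y (sect 1 \<tau>))) analytic_on {t}" if "a \<in> A" for a
  proof -
    have "a \<in> {1..2 * m}" using that by (simp add: A_def)
    then show ?thesis
      unfolding pd_wmon[OF \<open>a \<in> {1..2 * m}\<close>] A_def[symmetric]
      by (intro analytic_intros Y that) auto
  qed
  have "h analytic_on {t}"
    unfolding h_def using assms(5,6,7) by (intro analytic_intros pd) auto
  then obtain S where S: "open S" "t \<in> S" "h holomorphic_on S"
    by (auto simp: analytic_at)
  have "residue (\<lambda>\<tau>. let l = sect 1 \<tau> in
        (\<Sum>a\<in>A. pd a (wmon m p) (Y l) * mu_ope m osp a b l (sect s t)) *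
          angle iota l powi (3 - int (wt m p)) /
          (angle l z * angle iota z powi (3 - int (wt m p))) *
        (angle l (0, 1) / ((angle l osp)\<^sup>2 * (angle l iota)\<^sup>2))) t =
      residue (\<lambda>\<tau>. h \<tau> / (\<tau> - t)) t"
  proof (rule residue_cong)
    have ev: "\<forall>\<^sub>F \<tau> in at t. \<tau> \<noteq> snd osp" "\<forall>\<^sub>F \<tau> in at t. \<tau> \<noteq> t"
      using assms(5) by (auto simp: eventually_neq_at_within)
    have mu: "mu_ope m osp a b (sect 1 \<tau>) (sect s t) = eps m a b * (s * (snd osp - \<tau>) * (snd osp - t) / (\<tau> - t))"
      if "\<tau> \<noteq> t" for a \<tau>
    proof -
      have "angle (sect 1 \<tau>) (sect s t) = s * (\<tau> - t)" "angle osp (sect 1 \<tau>) = snd osp - \<tau>"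
        "angle osp (sect s t) = s * (snd osp - t)" "angle iota (sect 1 \<tau>) = 1" "angle iota (sect s t) = s"
        using assms(4) by (simp_all add: angle_def sect_def iota_def algebra_simps)
      then show ?thesis using assms(3) that by (simp add: mu_ope_def)
    qed
    show "\<forall>\<^sub>F \<tau> in at t. (let l = sect 1 \<tau> in
        (\<Sum>a\<in>A. pd a (wmon m p) (Y l) * mu_ope m osp a b l (sect s t)) *
          angle iota l powi (3 - int (wt m p)) /
          (angle l z * angle iota z powi (3 - int (wt m p))) *
        (angle l (0, 1) / ((angle l osp)\<^sup>2 * (angle l iota)\<^sup>2))) = h \<tau> / (\<tau> - t)"
      using ev
    proof eventually_elim
      case (elim \<tau>)
      define W where "W = (\<Sum>a\<in>A. eps m a b * pd a (wmon m p) (Y (sect 1 \<tau>)))"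
      have "(\<Sum>a\<in>A. pd a (wmon m p) (Y (sect 1 \<tau>)) * mu_ope m osp a b (sect 1 \<tau>) (sect s t)) =
          W * (s * (snd osp - \<tau>) * (snd osp - t) / (\<tau> - t))"
        unfolding W_def sum_distrib_right mu[OF elim(2)] by (simp add: mult_ac)
      moreover have "h \<tau> = s * W * (snd osp - t) / ((\<tau> * fst z - snd z) * fst z powi (3 - int (wt m p)) * (\<tau> - snd osp))"
        by (simp add: h_def W_def sum_distrib_left mult_ac)
      moreover have "angle iota (sect 1 \<tau>) = 1" "angle (sect 1 \<tau>) z = \<tau> * fst z - snd z"
        "angle (sect 1 \<tau>) (0, 1) = - 1" "angle (sect 1 \<tau>) osp = \<tau> - snd osp"
        "angle (sect 1 \<tau>) iota = - 1" "angle iota z = fst z"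
        using assms(4) by (simp_all add: angle_def sect_def iota_def)
      moreover have "W * (s * (snd osp - \<tau>) * e / k) / (q * r) * (- 1 / ((\<tau> - snd osp)\<^sup>2 * (- 1)\<^sup>2)) =
          s * W * e / (q * r * (\<tau> - snd osp)) / k" for e k q r
        using elim(1) by (simp add: divide_simps power2_eq_square) (simp add: algebra_simps)
      ultimately show ?case by (simp only: Let_def power_int_1_left mult_1_right)
    qed
  qed simp
  also have "\<dots> = h t" by (rule residue_simple[OF S])
  also have "h t = - (s powi (2 - int (wt m p)) * (\<Sum>a\<in>A. eps m a b * pd a (wmon m p) \<mu>) /
      ((t * fst z - snd z) * fst z powi (3 - int (wt m p))))"
  proof -
    have "Y (sect 1 t) c = \<mu> c / s" if "c \<in> A" for c
    proof -
      have "scale (1 / s) (sect s t) = sect 1 t"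
        using assms by (simp add: scale_def sect_def)
      then show ?thesis
        using assms that unfolding field_through_def A_def
        by (metis divide_eq_0_iff mult.commute mult_1 times_divide_eq_right zero_neq_one)
    qed
    then have "s * pd a (wmon m p) (Y (sect 1 t)) = s powi (2 - int (wt m p)) * pd a (wmon m p) \<mu>"
      if "a \<in> A" for a
      using that assms(3) unfolding A_def by (intro pd_wmon_scale) auto
    then have "(\<Sum>a\<in>A. eps m a b * (s * pd a (wmon m p) (Y (sect 1 t)))) =
        s powi (2 - int (wt m p)) * (\<Sum>a\<in>A. eps m a b * pd a (wmon m p) \<mu>)"
      by (simp add: sum_distrib_left mult_ac)
    then show ?thesis
      unfolding h_def using assms(5-7)
      by (simp add: divide_simps) (simp add: algebra_simps)
  qed
  finally show ?thesis
    unfolding contour_charge_def Y_def A_def by simp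
qed

lemma charge_action_eq:
  assumes "fst osp = 1" "s \<noteq> 0" "fst z' \<noteq> 0" "angle z' osp \<noteq> 0" "sq m \<mu> zt \<notin> \<real>\<^sub>\<le>\<^sub>0" "\<Delta> - 2 \<notin> \<int>\<^sub>\<le>\<^sub>0"
    "\<And>t. field_through m (X (sect s t)) \<mu> (sect s t)"
    "angle z z' \<noteq> 0" "fst z \<noteq> 0" "test_fun \<phi>"
  shows "charge_action m osp p z s X (cpw m \<Delta> s z' zt) \<mu> \<phi> =
    poisson_current m (wmon m p) (cpw m \<Delta> s z' zt) \<mu> \<phi> *
      (\<i> powi (int (wt m p) - 2) / angle z z' *
        (s powi (2 - int (wt m p)) * fst z' / fst z powi (3 - int (wt m p))))"
    and "poisson_current m (wmon m p) (cpw m \<Delta> s z' zt) \<mu> \<phi> =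
      (\<Sum>a\<in>{1..2 * m}. \<Sum>b\<in>{1..2 * m}. eps m a b * pd a (wmon m p) \<mu> * zt b) * \<i> * mellin_factor (\<Delta> + 1) (sq m \<mu> zt) *
        ((s / fst z') powr (\<Delta> + 1) / (2 * \<i> * s * fst z') * \<phi> (aff_coord z'))"
proof -
  define t' where "t' = aff_coord z'"
  define K where "K = \<i> * mellin_factor (\<Delta> + 1) (sq m \<mu> zt) * ((s / fst z') powr (\<Delta> + 1) / (2 * \<i> * s * fst z'))"
  define c where "c = \<i> powi (int (wt m p) - 2) * s powi (2 - int (wt m p))"
  define q where "q = fst z powi (3 - int (wt m p))"
  define w where "w b = (\<Sum>a\<in>{1..2 * m}. eps m a b * pd a (wmon m p) \<mu>)" for b
  define f where "f b t = contour_charge m osp p z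
      (\<lambda>l. \<Sum>a\<in>{1..2 * m}. pd a (wmon m p) (X (sect s t) l) * mu_ope m osp a b l (sect s t)) t" for b t
  \<comment> \<open>The set on which the residue has the closed form \<open>f\<close> below. It
    contains \<open>t'\<close> because \<open>angle z' osp\<close> and \<open>angle z z'\<close> are
    nonzero.\<close>
  define V where "V = {t. t \<noteq> snd osp} \<inter> {t. t * fst z - snd z \<noteq> 0}"
  have V: "open V" unfolding V_def by (intro open_Int open_Collect_neq continuous_intros)
  have t'V: "t' \<in> V"
    using assms(1,3,4,8) by (auto simp: V_def t'_def aff_coord_def angle_def field_simps)
  have f: "f b t = - (c * w b / ((t * fst z - snd z) * q))" if "t \<in> V" for b t
    using contour_charge_contraction[where X = X and s = s and t = t and m = m and \<mu> = \<mu> and osp = osp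
        and z = z and p = p and b = b] assms(7)[of t] assms(1,2) that assms(9)
    by (simp add: V_def f_def c_def w_def q_def)
  have "(\<lambda>t. - (c * w b / ((t * fst z - snd z) * q))) holomorphic_on V" for b
    using assms(9) by (intro holomorphic_intros) (auto simp: V_def q_def)
  from holomorphic_transform[OF this] have holo: "f b holomorphic_on V" for b
    using f by metis
  have H: "pd b (\<lambda>\<nu>. cpw m \<Delta> s z' zt \<nu> \<psi>) \<mu> = zt b * K * \<psi> t'"
    if "b \<in> {1..2 * m}" "test_fun \<psi>" for b \<psi>
    unfolding cpw_eq[OF assms(2,3) that(2)] pd_mellin_factor_mu[OF that(1) assms(5,6)]
    by (simp add: K_def t'_def)
  have P: "poisson_current m (wmon m p) (cpw m \<Delta> s z' zt) \<mu> \<phi> = (\<Sum>b\<in>{1..2 * m}. w b * zt b) * K * \<phi> t'"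
    unfolding poisson_current_def poisson_def w_def sum_distrib_right
    by (subst sum.swap) (intro sum.cong refl, simp add: H[OF _ assms(10)])
  have "charge_action m osp p z s X (cpw m \<Delta> s z' zt) \<mu> \<phi> = (\<Sum>b\<in>{1..2 * m}. zt b * K * (f b t' * \<phi> t'))"
    unfolding charge_action_def f_def[symmetric]
  proof (intro sum.cong refl)
    fix b assume b: "b \<in> {1..2 * m}"
    show "mult_current (f b) (\<lambda>\<psi>. pd b (\<lambda>\<nu>. cpw m \<Delta> s z' zt \<nu> \<psi>) \<mu>) \<phi> = zt b * K * (f b t' * \<phi> t')"
      by (rule mult_current_point_evaluation[OF _ V t'V holo assms(10)]) (rule H[OF b])
  qed
  also have "\<dots> = (\<Sum>b\<in>{1..2 * m}. w b * zt b * K * \<phi> t' * (- c / ((t' * fst z - snd z) * q)))"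
    by (intro sum.cong refl) (simp add: f[OF t'V])
  also have "\<dots> = poisson_current m (wmon m p) (cpw m \<Delta> s z' zt) \<mu> \<phi> * (- c / ((t' * fst z - snd z) * q))"
    unfolding P sum_distrib_right ..
  also have "- c / ((t' * fst z - snd z) * q) = \<i> powi (int (wt m p) - 2) / angle z z' *
        (s powi (2 - int (wt m p)) * fst z' / fst z powi (3 - int (wt m p)))"
  proof -
    \<comment> \<open>This sign cancels the minus sign of the residue.\<close>
    have "t' * fst z - snd z = - angle z z' / fst z'"
      using assms(3) by (simp add: t'_def aff_coord_def angle_def field_simps)
    then show ?thesis by (simp add: c_def q_def)
  qed
  finally show "charge_action m osp p z s X (cpw m \<Delta> s z' zt) \<mu> \<phi> =
    poisson_current m (wmon m p) (cpw m \<Delta> s z' zt) \<mu> \<phi> *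
      (\<i> powi (int (wt m p) - 2) / angle z z' *
        (s powi (2 - int (wt m p)) * fst z' / fst z powi (3 - int (wt m p))))" .
  have "(\<Sum>b\<in>{1..2 * m}. w b * zt b) = (\<Sum>a\<in>{1..2 * m}. \<Sum>b\<in>{1..2 * m}. eps m a b * pd a (wmon m p) \<mu> * zt b)"
    unfolding w_def sum_distrib_right by (rule sum.swap)
  then show "poisson_current m (wmon m p) (cpw m \<Delta> s z' zt) \<mu> \<phi> =
      (\<Sum>a\<in>{1..2 * m}. \<Sum>b\<in>{1..2 * m}. eps m a b * pd a (wmon m p) \<mu> * zt b) * \<i> * mellin_factor (\<Delta> + 1) (sq m \<mu> zt) *
        ((s / fst z') powr (\<Delta> + 1) / (2 * \<i> * s * fst z') * \<phi> (aff_coord z'))"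
    by (simp add: P K_def t'_def)
qed

text \<open>The multipliers in the first two forms depend on \<lambda> only through \<langle>\<iota>
  \<lambda>\<rangle>, which is s along the section. They are constant in t, and multiplying the
  current by them is ordinary multiplication.\<close>

lemma mult_current_const_poisson_current:
  assumes "s \<noteq> 0" "fst z' \<noteq> 0" "sq m \<mu> zt \<notin> \<real>\<^sub>\<le>\<^sub>0" "\<Delta> - 2 \<notin> \<int>\<^sub>\<le>\<^sub>0" "test_fun \<phi>"
  shows "mult_current (\<lambda>t. c) (poisson_current m w (cpw m \<Delta> s z' zt) \<mu>) \<phi> =
    poisson_current m w (cpw m \<Delta> s z' zt) \<mu> \<phi> * c"
proof -
  define k where "k = (\<Sum>a\<in>{1..2 * m}. \<Sum>b\<in>{1..2 * m}. eps m a b * pd a w \<mu> *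
      (\<i> * zt b * mellin_factor (\<Delta> + 1) (sq m \<mu> zt) * ((s / fst z') powr (\<Delta> + 1) / (2 * \<i> * s * fst z'))))"
  have "pd b (\<lambda>\<nu>. cpw m \<Delta> s z' zt \<nu> \<psi>) \<mu> =
      \<i> * zt b * mellin_factor (\<Delta> + 1) (sq m \<mu> zt) * ((s / fst z') powr (\<Delta> + 1) / (2 * \<i> * s * fst z')) *
        \<psi> (aff_coord z')" if "b \<in> {1..2 * m}" "test_fun \<psi>" for b \<psi>
    unfolding cpw_eq[OF assms(1,2) that(2)] pd_mellin_factor_mu[OF that(1) assms(3,4)] by simp
  note H = this
  have P: "poisson_current m w (cpw m \<Delta> s z' zt) \<mu> \<psi> = k * \<psi> (aff_coord z')" if "test_fun \<psi>" for \<psi>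
    unfolding poisson_current_def poisson_def k_def sum_distrib_right
    by (intro sum.cong refl) (simp add: H[OF _ that])
  have "mult_current (\<lambda>t. c) (poisson_current m w (cpw m \<Delta> s z' zt) \<mu>) \<phi> = k * (c * \<phi> (aff_coord z'))"
    by (rule mult_current_point_evaluation[OF P, of _ UNIV]) (use assms(5) in auto)
  then show ?thesis by (simp add: P[OF assms(5)])
qed

lemma ope_sim_eventually_eq:
  assumes "\<And>\<phi>. test_fun \<phi> \<Longrightarrow> \<forall>\<^sub>F x in F. A x \<phi> = B x \<phi>"
  shows "ope_sim F A B"
  unfolding ope_sim_def
proof (intro allI impI)
  fix \<phi> assume "test_fun \<phi>"
  then have "\<forall>\<^sub>F x in F. A x \<phi> - B x \<phi> = 0" using assms by (auto elim: eventually_mono)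
  then show "(\<lambda>x. A x \<phi> - B x \<phi>) \<in> O[F](\<lambda>_. 1)"
    by (intro bigoI[of _ 0]) (auto elim: eventually_mono)
qed

section \<open>The celestial operator\<close>

text \<open>\<open>represents m \<mu> f c \<Delta>\<close>: on the patch \<open>z\<^sub>1 = 1\<close>, and off the cut, \<open>f\<close> is \<open>c\<close> times the
  \<open>z\<close>-dependence of the wavefunction of dimension \<open>\<Delta>\<close>.  All operators in
  the celestial formula map such functions to such functions.\<close>

definition patch :: "nat \<Rightarrow> (nat \<Rightarrow> complex) \<Rightarrow> (nat \<Rightarrow> complex) set" where
  "patch m \<mu> = {\<zeta>. \<zeta> 1 = 1 \<and> sq m \<mu> \<zeta> \<notin> \<real>\<^sub>\<le>\<^sub>0}"

definition represents ::
  "nat \<Rightarrow> (nat \<Rightarrow> complex) \<Rightarrow> ((nat \<Rightarrow> complex) \<Rightarrow> complex) \<Rightarrow> complex \<Rightarrow> complex \<Rightarrow> bool"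
where
  "represents m \<mu> f c \<Delta> \<longleftrightarrow> (\<forall>\<zeta>\<in>patch m \<mu>. f \<zeta> = c * mellin_factor \<Delta> (sq m \<mu> \<zeta>))"

section \<open>Operators that raise the dimension by one\<close>

lemma nonpos_Ints_add_nat: "(z::complex) \<notin> \<int>\<^sub>\<le>\<^sub>0 \<Longrightarrow> z + of_nat n \<notin> \<int>\<^sub>\<le>\<^sub>0"
proof
  assume z: "z \<notin> \<int>\<^sub>\<le>\<^sub>0" "z + of_nat n \<in> \<int>\<^sub>\<le>\<^sub>0"
  then obtain k :: int where k: "k \<le> 0" "z + of_nat n = of_int k"
    by (auto simp: nonpos_Ints_def)
  then have "z = of_int (k - int n)" by (simp add: algebra_simps)
  then have "z \<in> \<int>\<^sub>\<le>\<^sub>0" using k(1) by (simp only: nonpos_Ints_of_int)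
  with z(1) show False ..
qed

lemma represents_pd:
  assumes f: "represents m \<mu> f c \<Delta>" and \<Delta>: "\<Delta> - 2 \<notin> \<int>\<^sub>\<le>\<^sub>0" and a: "a \<in> {2..2 * m}"
  shows "represents m \<mu> (pd a f) (c * (\<i> * \<mu> a)) (\<Delta> + 1)"
  unfolding represents_def
proof
  fix \<zeta> assume \<zeta>: "\<zeta> \<in> patch m \<mu>"
  have a': "a \<in> {1..2 * m}" using a by simp
  \<comment> \<open>\<open>f\<close> is known only on the patch. Changing a coordinate a \<ge> 2
    preserves \<open>\<zeta> 1 = 1\<close>, and the complement of the cut is open, so the known
    formula holds for u near \<open>\<zeta> a\<close>, which is all that the derivative
    sees.\<close>
  have "open {u. sq m \<mu> \<zeta> + (u - \<zeta> a) * \<mu> a \<in> - \<real>\<^sub>\<le>\<^sub>0}"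
    by (intro open_vimage[unfolded vimage_def] continuous_intros) auto
  moreover have "\<zeta> a \<in> {u. sq m \<mu> \<zeta> + (u - \<zeta> a) * \<mu> a \<in> - \<real>\<^sub>\<le>\<^sub>0}"
    using \<zeta> by (simp add: patch_def)
  ultimately have "\<forall>\<^sub>F u in nhds (\<zeta> a). u \<in> {u. sq m \<mu> \<zeta> + (u - \<zeta> a) * \<mu> a \<in> - \<real>\<^sub>\<le>\<^sub>0}"
    by (rule eventually_nhds_in_open)
  then have "\<forall>\<^sub>F u in nhds (\<zeta> a). f (\<zeta>(a := u)) = mellin_factor \<Delta> (sq m (\<zeta>(a := u)) \<mu>) * c"
  proof eventually_elim
    case (elim u)
    then have "\<zeta>(a := u) \<in> patch m \<mu>"
      using \<zeta> a sq_fun_upd_left[OF a', of \<zeta> u \<mu>] by (simp add: patch_def sq_commute[of m \<mu>])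
    then show ?case using f by (simp add: represents_def sq_commute)
  qed
  then have "pd a f \<zeta> = pd a (\<lambda>\<zeta>. mellin_factor \<Delta> (sq m \<zeta> \<mu>) * c) \<zeta>"
    unfolding pd_def by (intro deriv_cong_ev refl)
  also have "\<dots> = \<i> * \<mu> a * mellin_factor (\<Delta> + 1) (sq m \<zeta> \<mu>) * c"
    using \<zeta> by (intro pd_mellin_factor_mu a' \<Delta>) (simp add: patch_def sq_commute)
  finally show "pd a f \<zeta> = c * (\<i> * \<mu> a) * mellin_factor (\<Delta> + 1) (sq m \<mu> \<zeta>)"
    by (simp add: sq_commute)
qed

lemma represents_pd_power:
  assumes f: "represents m \<mu> f c \<Delta>" and \<Delta>: "\<Delta> - 2 \<notin> \<int>\<^sub>\<le>\<^sub>0" and a: "a \<in> {2..2 * m}"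
  shows "represents m \<mu> ((pd a ^^ n) f) (c * (\<i> * \<mu> a) ^ n) (\<Delta> + of_nat n)"
proof (induction n)
  case (Suc n)
  have "represents m \<mu> (pd a ((pd a ^^ n) f)) (c * (\<i> * \<mu> a) ^ n * (\<i> * \<mu> a)) (\<Delta> + of_nat n + 1)"
    using nonpos_Ints_add_nat[OF \<Delta>, of n]
    by (intro represents_pd[OF Suc _ a]) (simp add: algebra_simps)
  then show ?case by (simp add: mult_ac add_ac)
qed (use f in simp)

lemma represents_pd_prod:
  assumes f: "represents m \<mu> f c \<Delta>" and \<Delta>: "\<Delta> - 2 \<notin> \<int>\<^sub>\<le>\<^sub>0"
  shows "represents m \<mu> (pd_prod m p B f) (c * (\<Prod>b\<in>{2..2 * m} - B. (\<i> * \<mu> b) ^ p b))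
    (\<Delta> + of_nat (\<Sum>b\<in>{2..2 * m} - B. p b))"
proof -
  have list: "represents m \<mu> (foldr (\<lambda>b A. (pd b ^^ p b) \<circ> A) bs id f)
      (c * (\<Prod>b\<leftarrow>bs. (\<i> * \<mu> b) ^ p b)) (\<Delta> + of_nat (\<Sum>b\<leftarrow>bs. p b))"
    if "set bs \<subseteq> {2..2 * m}" for bs
    using that
  proof (induction bs)
    case (Cons b bs)
    then have b: "b \<in> {2..2 * m}" and bs: "set bs \<subseteq> {2..2 * m}" by auto
    have "\<Delta> + of_nat (\<Sum>b\<leftarrow>bs. p b) - 2 \<notin> \<int>\<^sub>\<le>\<^sub>0"
      using nonpos_Ints_add_nat[OF \<Delta>, of "\<Sum>b\<leftarrow>bs. p b"] by (simp add: algebra_simps)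
    from represents_pd_power[OF Cons.IH[OF bs] this b, of "p b"]
    have "represents m \<mu> ((pd b ^^ p b) (foldr (\<lambda>b A. (pd b ^^ p b) \<circ> A) bs id f))
        (c * (\<Prod>b\<leftarrow>bs. (\<i> * \<mu> b) ^ p b) * (\<i> * \<mu> b) ^ p b) (\<Delta> + of_nat (\<Sum>b\<leftarrow>bs. p b) + of_nat (p b))" .
    moreover have "foldr (\<lambda>b A. (pd b ^^ p b) \<circ> A) (b # bs) id f =
        (pd b ^^ p b) (foldr (\<lambda>b A. (pd b ^^ p b) \<circ> A) bs id f)" by simp
    ultimately show ?case
      by (simp only: list.map prod_list.Cons sum_list.Cons of_nat_add mult_ac add_ac)
  qed (use f in simp)
  let ?bs = "filter (\<lambda>b. b \<notin> B) [2..<2 * m + 1]"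
  have set: "set ?bs = {2..2 * m} - B" by auto
  have "distinct ?bs" by simp
  note conv = prod.distinct_set_conv_list[OF this, unfolded set, symmetric]
    sum.distinct_set_conv_list[OF this, unfolded set, symmetric]
  have "set ?bs \<subseteq> {2..2 * m}" unfolding set by blast
  from list[OF this] show ?thesis unfolding pd_prod_def conv .
qed

text \<open>As \<open>\<zeta> 1 = 1\<close>, the Euler operator over a \<ge> 2 produces \<i> times
  the full pairing minus \<i> \<mu>^1. By the recursion the full pairing contributes -(\<Delta> - 2)
  f, which the added multiple of f cancels, leaving -\<i> \<mu>^1.\<close>

lemma represents_upsilon:
  assumes f: "represents m \<mu> f c \<Delta>" and \<Delta>: "\<Delta> - 2 \<notin> \<int>\<^sub>\<le>\<^sub>0" and m: "m \<ge> 1"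
  shows "represents m \<mu> (\<lambda>\<zeta>. upsilon m f \<zeta> + (\<Delta> - 2) * f \<zeta>) (c * (- \<i> * \<mu> 1)) (\<Delta> + 1)"
  unfolding represents_def
proof
  fix \<zeta> assume \<zeta>: "\<zeta> \<in> patch m \<mu>"
  define M where "M = mellin_factor (\<Delta> + 1) (sq m \<mu> \<zeta>)"
  have "{1..2 * m} = insert 1 {2..2 * m}" using m by auto
  then have sq: "sq m \<mu> \<zeta> = \<mu> 1 + (\<Sum>a\<in>{2..2 * m}. \<mu> a * \<zeta> a)"
    using \<zeta> by (simp add: sq_def patch_def)
  have "pd a f \<zeta> = c * (\<i> * \<mu> a) * M" if "a \<in> {2..2 * m}" for a
    using represents_pd[OF f \<Delta> that] \<zeta> by (simp add: represents_def M_def)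
  then have "upsilon m f \<zeta> = (\<Sum>a\<in>{2..2 * m}. \<mu> a * \<zeta> a * (c * \<i> * M))"
    unfolding upsilon_def by (intro sum.cong) auto
  also have "\<dots> = (sq m \<mu> \<zeta> - \<mu> 1) * (c * \<i> * M)"
    unfolding sq by (simp only: add_diff_cancel_left' sum_distrib_right)
  finally have "upsilon m f \<zeta> = c * (\<i> * sq m \<mu> \<zeta> * M) - c * (\<i> * \<mu> 1 * M)"
    by (simp add: algebra_simps)
  also have "\<i> * sq m \<mu> \<zeta> * M = - (\<Delta> - 2) * mellin_factor \<Delta> (sq m \<mu> \<zeta>)"
    unfolding M_def using \<zeta> by (intro mellin_factor_recursion \<Delta>) (auto simp: patch_def)
  finally show "upsilon m f \<zeta> + (\<Delta> - 2) * f \<zeta> = c * (- \<i> * \<mu> 1) * mellin_factor (\<Delta> + 1) (sq m \<mu> \<zeta>)"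
    using f \<zeta> by (simp add: represents_def M_def algebra_simps)
qed

lemma foldr_comp_id: "foldr (\<lambda>x A. F x \<circ> A) xs A = foldr (\<lambda>x A. F x \<circ> A) xs id \<circ> A"
  by (induction xs) (auto simp: comp_assoc)

text \<open>The fold applies the factor r = n - 1 first. Factor r is the raising operator at
  dimension \<Delta> - r, so the factors fit together exactly when the start is \<Delta> + 1 - n.
  The induction peels off the innermost factor, hence f and c vary.\<close>

lemma represents_ups_prod:
  assumes "represents m \<mu> f c (\<Delta> + 1 - of_nat n)" "\<Delta> + 1 - of_nat n - 2 \<notin> \<int>\<^sub>\<le>\<^sub>0" "m \<ge> 1"
  shows "represents m \<mu> (ups_prod m \<Delta> n f) (c * (- \<i> * \<mu> 1) ^ n) (\<Delta> + 1)"
  using assms(1,2)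
proof (induction n arbitrary: f c)
  case 0
  then show ?case by (simp add: ups_prod_def)
next
  case (Suc n)
  let ?s = "\<lambda>\<zeta>. upsilon m f \<zeta> + (\<Delta> - 2 - of_nat n) * f \<zeta>"
  have eq: "ups_prod m \<Delta> (Suc n) f = ups_prod m \<Delta> n ?s"
    unfolding ups_prod_def by (simp, subst foldr_comp_id) simp
  have r: "represents m \<mu> ?s (c * (- \<i> * \<mu> 1)) (\<Delta> + 1 - of_nat n)"
    using represents_upsilon[OF Suc.prems(1,2) assms(3)] by (simp add: algebra_simps)
  have "\<Delta> + 1 - of_nat n - 2 \<notin> \<int>\<^sub>\<le>\<^sub>0"
    using nonpos_Ints_add_nat[OF Suc.prems(2), of 1] by (simp add: algebra_simps)
  from Suc.IH[OF r this]
  have "represents m \<mu> (ups_prod m \<Delta> (Suc n) f) (c * (- \<i> * \<mu> 1) * (- \<i> * \<mu> 1) ^ n) (\<Delta> + 1)"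
    unfolding eq .
  then show ?case by (simp only: power_Suc mult.assoc)
qed

section \<open>The celestial operator as a Poisson bracket\<close>

lemma sum_eps:
  "(\<Sum>a\<in>{1..2 * m}. \<Sum>b\<in>{1..2 * m}. eps m a b * u a * v b) =
    (\<Sum>i\<in>{1..m}. u i * v (i + m) - u (i + m) * v i)"
proof -
  have U: "{1..2 * m} = {1..m} \<union> (\<lambda>i. i + m) ` {1..m}" "{1..m} \<inter> (\<lambda>i. i + m) ` {1..m} = {}"
    by (auto simp: image_iff)
  have split: "(\<Sum>a\<in>{1..2 * m}. g a) = (\<Sum>i\<in>{1..m}. g i) + (\<Sum>i\<in>{1..m}. g (i + m))"
    for g :: "nat \<Rightarrow> complex"
    unfolding U(1) sum.union_disjoint[OF finite_atLeastAtMost finite_imageI[OF finite_atLeastAtMost] U(2)]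
    by (subst sum.reindex) (auto simp: inj_on_def)
  have "(\<Sum>b\<in>{1..2 * m}. eps m i b * u i * v b) = u i * v (i + m)" if "i \<in> {1..m}" for i
  proof -
    have "(\<Sum>b\<in>{1..2 * m}. eps m i b * u i * v b) = (\<Sum>b\<in>{1..2 * m}. if b = i + m then u i * v (i + m) else 0)"
      using that by (intro sum.cong) (auto simp: eps_def)
    then show ?thesis using that by simp
  qed
  moreover have "(\<Sum>b\<in>{1..2 * m}. eps m (i + m) b * u (i + m) * v b) = - (u (i + m) * v i)" if "i \<in> {1..m}" for i
  proof -
    have "(\<Sum>b\<in>{1..2 * m}. eps m (i + m) b * u (i + m) * v b) =
        (\<Sum>b\<in>{1..2 * m}. if b = i then - (u (i + m) * v i) else 0)"
      using that by (intro sum.cong) (auto simp: eps_def)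
    then show ?thesis using that by simp
  qed
  ultimately show ?thesis
    unfolding split[of "\<lambda>a. \<Sum>b\<in>{1..2 * m}. eps m a b * u a * v b"]
    by (simp add: sum_negf sum_subtractf)
qed

text \<open>The operator word that belongs to an index a multiplies by the monomial with one factor
  \<mu>^a removed, up to a phase, and the prefactor p_a completes this to the derivative
  \<open>w a\<close>. All words have length P - 1 and share the phase in \<open>J\<close>. The term
  with \<open>p (1 + m)\<close> carries no coordinate because \<open>zt 1 = 1\<close>.\<close>

lemma celestial_op_eq:
  assumes m: "m \<ge> 1" and zt: "zt \<in> patch m \<mu>" and \<Delta>: "\<Delta> - of_nat (wt m p) \<notin> \<int>\<^sub>\<le>\<^sub>0"
    and f: "represents m \<mu> f c (\<Delta> - of_nat (wt m p) + 2)"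
  shows "celestial_op m p \<Delta> f zt = \<i> powi (int (wt m p) - 2) * \<i> * c * mellin_factor (\<Delta> + 1) (sq m \<mu> zt) *
    (\<Sum>a\<in>{1..2 * m}. \<Sum>b\<in>{1..2 * m}. eps m a b * pd a (wmon m p) \<mu> * zt b)"
proof -
  define J where "J = \<i> powi (int (wt m p) - 2) * \<i> * (c * mellin_factor (\<Delta> + 1) (sq m \<mu> zt))"
  define w where "w a = pd a (wmon m p) \<mu>" for a
  have ins: "{1..2 * m} = insert 1 {2..2 * m}" using m by auto
  have wt: "wt m p = p 1 + (\<Sum>b\<in>{2..2 * m}. p b)" unfolding wt_def ins by simp
  \<comment> \<open>The exponent P - 2 is -1 for P = 1, hence the integer power; the further \<i>,
    which comes from the \<mu>-derivative of the wavefunction, makes it the natural power P -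
    1.\<close>
  have J: "J = \<i> ^ n * (c * mellin_factor (\<Delta> + 1) (sq m \<mu> zt))" if "wt m p = Suc n" for n
  proof -
    have "\<i> powi (int (wt m p) - 2) = \<i> powi (int n - 1)" using that by simp
    also have "\<dots> = \<i> powi int n / \<i> powi 1" by (rule power_int_diff) simp
    also have "\<dots> * \<i> = \<i> ^ n"
      unfolding power_int_of_nat power_int_1_right times_divide_eq_left
      by (rule nonzero_mult_div_cancel_right) simp
    finally show ?thesis by (simp add: J_def)
  qed
  note pole = nonpos_Ints_add_nat[OF \<Delta>]
  \<comment> \<open>Here only p_1 - 1 factors -\<i> \<mu>^1 occur, against p_1 in all other terms.
    This gives the opposite sign to \<open>rest\<close> and explains the signs in the celestial
    operator.\<close>
  have first: "of_nat (p 1) * ups_prod m \<Delta> (p 1 - 1) (pd_prod m p {} f) zt = - ((- 1) ^ p 1) * J * w 1"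
  proof (cases "p 1")
    case 0
    have "w 1 = 0" using 0 m unfolding w_def by (subst pd_wmon) auto
    then show ?thesis using 0 by simp
  next
    case (Suc k)
    define N where "N = (\<Sum>b\<in>{2..2 * m}. p b)"
    have "represents m \<mu> (pd_prod m p {} f) (c * (\<Prod>b\<in>{2..2 * m}. (\<i> * \<mu> b) ^ p b)) (\<Delta> + 1 - of_nat k)"
      using represents_pd_prod[OF f, of p "{}"] \<Delta> Suc by (simp add: wt algebra_simps)
    moreover have "\<Delta> + 1 - of_nat k - 2 \<notin> \<int>\<^sub>\<le>\<^sub>0"
      using pole[of N] Suc by (simp add: wt N_def algebra_simps)
    ultimately have "represents m \<mu> (ups_prod m \<Delta> k (pd_prod m p {} f))
        (c * (\<Prod>b\<in>{2..2 * m}. (\<i> * \<mu> b) ^ p b) * (- \<i> * \<mu> 1) ^ k) (\<Delta> + 1)"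
      using m by (rule represents_ups_prod)
    then have "ups_prod m \<Delta> k (pd_prod m p {} f) zt =
        c * (\<Prod>b\<in>{2..2 * m}. (\<i> * \<mu> b) ^ p b) * (- \<i> * \<mu> 1) ^ k * mellin_factor (\<Delta> + 1) (sq m \<mu> zt)"
      using zt by (simp add: represents_def)
    also have "(\<Prod>b\<in>{2..2 * m}. (\<i> * \<mu> b) ^ p b) = \<i> ^ N * (\<Prod>b\<in>{2..2 * m}. \<mu> b ^ p b)"
      by (simp add: power_mult_distrib prod.distrib power_sum N_def)
    also have "(- \<i> * \<mu> 1) ^ k = (- 1) ^ k * \<i> ^ k * \<mu> 1 ^ k"
      by (simp only: power_mult_distrib[symmetric]) simp
    also have "{2..2 * m} = {1..2 * m} - {1}" by auto
    finally have *: "ups_prod m \<Delta> k (pd_prod m p {} f) zt = c * (\<i> ^ N * (\<Prod>b\<in>{1..2 * m} - {1}. \<mu> b ^ p b)) *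
        ((- 1) ^ k * \<i> ^ k * \<mu> 1 ^ k) * mellin_factor (\<Delta> + 1) (sq m \<mu> zt)" .
    have w1: "w 1 = of_nat (p 1) * \<mu> 1 ^ k * (\<Prod>b\<in>{1..2 * m} - {1}. \<mu> b ^ p b)"
    proof -
      have "1 \<in> {1..2 * m}" using m by simp
      then show ?thesis unfolding w_def pd_wmon[OF \<open>1 \<in> {1..2 * m}\<close>] by (simp only: Suc diff_Suc_1)
    qed
    have "of_nat (p 1) * ups_prod m \<Delta> k (pd_prod m p {} f) zt =
        (- 1) ^ k * (\<i> ^ (k + N) * (c * mellin_factor (\<Delta> + 1) (sq m \<mu> zt))) * w 1"
      unfolding * w1 power_add by (simp only: mult_ac)
    also have "\<i> ^ (k + N) * (c * mellin_factor (\<Delta> + 1) (sq m \<mu> zt)) = J"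
      by (rule J[symmetric]) (use Suc in \<open>simp add: wt N_def\<close>)
    finally show ?thesis using Suc by simp
  qed
  have rest: "of_nat (p b) * ups_prod m \<Delta> (p 1) ((pd b ^^ (p b - 1)) (pd_prod m p {b} f)) zt =
      (- 1) ^ p 1 * J * w b" if b: "b \<in> {2..2 * m}" for b
  proof (cases "p b")
    case 0
    have "w b = 0" using 0 b unfolding w_def by (subst pd_wmon) auto
    then show ?thesis using 0 by simp
  next
    case (Suc k)
    define N where "N = (\<Sum>b\<in>{2..2 * m} - {b}. p b)"
    have N: "(\<Sum>b\<in>{2..2 * m}. p b) = p b + N"
      unfolding N_def using b by (subst sum.remove[of _ b]) auto
    have "represents m \<mu> (pd_prod m p {b} f) (c * (\<Prod>b\<in>{2..2 * m} - {b}. (\<i> * \<mu> b) ^ p b))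
        (\<Delta> - of_nat (wt m p) + 2 + of_nat N)"
      unfolding N_def using \<Delta> by (intro represents_pd_prod f) simp
    then have "represents m \<mu> ((pd b ^^ k) (pd_prod m p {b} f))
        (c * (\<Prod>b\<in>{2..2 * m} - {b}. (\<i> * \<mu> b) ^ p b) * (\<i> * \<mu> b) ^ k)
        (\<Delta> - of_nat (wt m p) + 2 + of_nat N + of_nat k)"
      using pole[of N] b by (intro represents_pd_power) (auto simp: algebra_simps)
    also have "\<Delta> - of_nat (wt m p) + 2 + of_nat N + of_nat k = \<Delta> + 1 - of_nat (p 1)"
      by (simp add: wt N Suc)
    finally have r: "represents m \<mu> ((pd b ^^ k) (pd_prod m p {b} f))
        (c * (\<Prod>b\<in>{2..2 * m} - {b}. (\<i> * \<mu> b) ^ p b) * (\<i> * \<mu> b) ^ k) (\<Delta> + 1 - of_nat (p 1))" .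
    have "\<Delta> - of_nat (wt m p) + of_nat (N + k) = \<Delta> + 1 - of_nat (p 1) - 2"
      unfolding wt N Suc by simp
    then have "\<Delta> + 1 - of_nat (p 1) - 2 \<notin> \<int>\<^sub>\<le>\<^sub>0" using pole[of "N + k"] by argo
    from represents_ups_prod[OF r this m]
    have "represents m \<mu> (ups_prod m \<Delta> (p 1) ((pd b ^^ k) (pd_prod m p {b} f)))
        (c * (\<Prod>b\<in>{2..2 * m} - {b}. (\<i> * \<mu> b) ^ p b) * (\<i> * \<mu> b) ^ k * (- \<i> * \<mu> 1) ^ p 1) (\<Delta> + 1)" .
    then have "ups_prod m \<Delta> (p 1) ((pd b ^^ k) (pd_prod m p {b} f)) zt =
        c * (\<Prod>b\<in>{2..2 * m} - {b}. (\<i> * \<mu> b) ^ p b) * (\<i> * \<mu> b) ^ k * (- \<i> * \<mu> 1) ^ p 1 *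
          mellin_factor (\<Delta> + 1) (sq m \<mu> zt)"
      using zt by (simp add: represents_def)
    also have "(\<Prod>b\<in>{2..2 * m} - {b}. (\<i> * \<mu> b) ^ p b) = \<i> ^ N * (\<Prod>b\<in>{2..2 * m} - {b}. \<mu> b ^ p b)"
      by (simp add: power_mult_distrib prod.distrib power_sum N_def)
    also have "(- \<i> * \<mu> 1) ^ p 1 = (- 1) ^ p 1 * \<i> ^ p 1 * \<mu> 1 ^ p 1"
      by (simp only: power_mult_distrib[symmetric]) simp
    finally have "of_nat (p b) * ups_prod m \<Delta> (p 1) ((pd b ^^ k) (pd_prod m p {b} f)) zt =
        (- 1) ^ p 1 * (\<i> ^ (p 1 + N + k) * (c * mellin_factor (\<Delta> + 1) (sq m \<mu> zt))) *
          (of_nat (p b) * \<mu> b ^ k * (\<mu> 1 ^ p 1 * (\<Prod>b\<in>{2..2 * m} - {b}. \<mu> b ^ p b)))"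
      by (simp add: power_add power_mult_distrib mult_ac)
    also have "\<mu> 1 ^ p 1 * (\<Prod>b\<in>{2..2 * m} - {b}. \<mu> b ^ p b) = (\<Prod>b\<in>{1..2 * m} - {b}. \<mu> b ^ p b)"
    proof -
      have "{1..2 * m} - {b} = insert 1 ({2..2 * m} - {b})" using b by auto
      then show ?thesis by simp
    qed
    also have "of_nat (p b) * \<mu> b ^ k * (\<Prod>b\<in>{1..2 * m} - {b}. \<mu> b ^ p b) = w b"
      unfolding w_def using b by (subst pd_wmon) (auto simp: Suc)
    also have "\<i> ^ (p 1 + N + k) * (c * mellin_factor (\<Delta> + 1) (sq m \<mu> zt)) = J"
      by (rule J[symmetric]) (simp add: wt N Suc)
    finally show ?thesis by (simp add: Suc)
  qed
  have sgn: "(- 1) ^ p 1 * ((- 1) ^ p 1 * x) = x" for x :: complex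
    by (simp flip: mult.assoc power_mult_distrib)
  have "celestial_op m p \<Delta> f zt =
     - ((- 1) ^ p 1) *
     (zt (m + 1) * (- ((- 1) ^ p 1) * J * w 1) + (- 1) ^ p 1 * J * w (1 + m)
      - (\<Sum>i\<in>{2..m}. zt (i + m) * ((- 1) ^ p 1 * J * w i) - zt i * ((- 1) ^ p 1 * J * w (i + m))))"
  proof -
    have rest': "of_nat (p b) * y * ups_prod m \<Delta> (p 1) ((pd b ^^ (p b - 1)) (pd_prod m p {b} f)) zt =
        y * ((- 1) ^ p 1 * J * w b)" if "b \<in> {2..2 * m}" for b y
      unfolding rest[OF that, symmetric] by (simp only: mult_ac)
    have first': "of_nat (p 1) * zt (m + 1) * ups_prod m \<Delta> (p 1 - 1) (pd_prod m p {} f) zt =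
        zt (m + 1) * (- ((- 1) ^ p 1) * J * w 1)"
      unfolding first[symmetric] by (simp only: mult_ac)
    have "1 + m \<in> {2..2 * m}" using m by simp
    moreover have "i \<in> {2..2 * m}" "i + m \<in> {2..2 * m}" if "i \<in> {2..m}" for i
      using that by auto
    ultimately show ?thesis
      unfolding celestial_op_def first' by (simp only: rest rest' cong: sum.cong)
  qed
  also have "\<dots> = J * (w 1 * zt (1 + m) - w (1 + m) + (\<Sum>i\<in>{2..m}. w i * zt (i + m) - w (i + m) * zt i))"
  proof -
    have "(\<Sum>i\<in>{2..m}. zt (i + m) * ((- 1) ^ p 1 * J * w i) - zt i * ((- 1) ^ p 1 * J * w (i + m))) =
        (- 1) ^ p 1 * (J * (\<Sum>i\<in>{2..m}. w i * zt (i + m) - w (i + m) * zt i))"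
      by (simp add: sum_distrib_left algebra_simps)
    then show ?thesis by (simp add: algebra_simps sgn)
  qed
  also have "w 1 * zt (1 + m) - w (1 + m) + (\<Sum>i\<in>{2..m}. w i * zt (i + m) - w (i + m) * zt i) =
      (\<Sum>i\<in>{1..m}. w i * zt (i + m) - w (i + m) * zt i)"
  proof -
    have "{1..m} = insert 1 {2..m}" using m by auto
    then show ?thesis using zt by (simp add: patch_def)
  qed
  finally show ?thesis
    unfolding sum_eps by (simp add: J_def w_def mult_ac)
qed

section \<open>The celestial OPE\<close>

theorem mainTheorem6:
  fixes m :: nat and p :: "nat \<Rightarrow> nat" and \<Delta> s :: complex
    and osp z' :: spinor and \<mu> zt :: "nat \<Rightarrow> complex"
    and X :: "spinor \<Rightarrow> spinor \<Rightarrow> nat \<Rightarrow> complex"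
  assumes "m \<ge> 1"
    and "angle iota osp = 1"
    and "s \<noteq> 0"
    and "angle iota z' \<noteq> 0" and "angle z' osp \<noteq> 0"
    and "sq m \<mu> zt \<notin> \<real>\<^sub>\<le>\<^sub>0"
    and "\<Delta> - 2 \<notin> \<int>\<^sub>\<le>\<^sub>0"
    and "\<And>t. field_through m (X (sect s t)) \<mu> (sect s t)"
  shows
    "ope_sim (at z' within {z. angle z z' \<noteq> 0})
       (\<lambda>z. charge_action m osp p z s X (cpw m \<Delta> s z' zt) \<mu>)
       (\<lambda>z. mult_current
          (\<lambda>t. \<i> powi (int (wt m p) - 2) / angle z z' *
               (angle iota (sect s t) powi (2 - int (wt m p)) * angle iota z' /
                angle iota z powi (3 - int (wt m p))))
          (poisson_current m (wmon m p) (cpw m \<Delta> s z' zt) \<mu>))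
     \<and> (angle iota z' = 1 \<longrightarrow>
       ope_sim (at z' within {z. angle iota z = 1})
         (\<lambda>z. charge_action m osp p z s X (cpw m \<Delta> s z' zt) \<mu>)
         (\<lambda>z. mult_current
            (\<lambda>t. \<i> powi (int (wt m p) - 2) / (snd z - snd z') /
                 angle iota (sect s t) powi (int (wt m p) - 2))
            (poisson_current m (wmon m p) (cpw m \<Delta> s z' zt) \<mu>)))
     \<and> (angle iota z' = 1 \<and> zt 1 = 1 \<and> \<Delta> - of_nat (wt m p) \<notin> \<int>\<^sub>\<le>\<^sub>0 \<longrightarrow>
       ope_sim (at z' within {z. angle iota z = 1})
         (\<lambda>z. charge_action m osp p z s X (cpw m \<Delta> s z' zt) \<mu>)
         (\<lambda>z \<phi>. 1 / (snd z - snd z') *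
            celestial_op m p \<Delta> (\<lambda>\<zeta>. cpw m (\<Delta> - of_nat (wt m p) + 2) s z \<zeta> \<mu> \<phi>) zt))"
proof -
  let ?Q = "\<lambda>z. charge_action m osp p z s X (cpw m \<Delta> s z' zt) \<mu>"
  let ?PB = "poisson_current m (wmon m p) (cpw m \<Delta> s z' zt) \<mu>"
  have iota: "angle iota l = fst l" for l by (simp add: angle_def iota_def)
  have fst': "fst osp = 1" "fst z' \<noteq> 0" using assms(2,4) by (simp_all add: iota)
  note charge = charge_action_eq[OF fst'(1) assms(3) fst'(2) assms(5-7), where X = X, OF assms(8)]
  note const = mult_current_const_poisson_current[OF assms(3) fst'(2) assms(6,7)]
  have "ope_sim (at z' within {z. angle z z' \<noteq> 0}) ?Q
     (\<lambda>z. mult_current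
        (\<lambda>t. \<i> powi (int (wt m p) - 2) / angle z z' *
             (angle iota (sect s t) powi (2 - int (wt m p)) * angle iota z' /
              angle iota z powi (3 - int (wt m p)))) ?PB)"
  proof (rule ope_sim_eventually_eq)
    fix \<phi> assume \<phi>: "test_fun \<phi>"
    have "\<forall>\<^sub>F z in at z' within {z. angle z z' \<noteq> 0}. fst z \<noteq> 0"
      using fst'(2) by (intro tendsto_imp_eventually_ne[of _ "fst z'"] tendsto_intros)
    moreover have "\<forall>\<^sub>F z in at z' within {z. angle z z' \<noteq> 0}. angle z z' \<noteq> 0"
      by (simp add: eventually_at_filter)
    ultimately show "\<forall>\<^sub>F z in at z' within {z. angle z z' \<noteq> 0}. ?Q z \<phi> = mult_current
        (\<lambda>t. \<i> powi (int (wt m p) - 2) / angle z z' *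
             (angle iota (sect s t) powi (2 - int (wt m p)) * angle iota z' /
              angle iota z powi (3 - int (wt m p)))) ?PB \<phi>"
    proof eventually_elim
      case (elim z)
      show ?case
        unfolding const[OF \<phi>] iota sect_def fst_conv by (rule charge(1)[OF elim(2,1) \<phi>])
    qed
  qed
  \<comment> \<open>On the slice where the first component is 1, the bracket is the difference of
    affine coordinates, and a point other than z' must differ from it in the second
    component.\<close>
  moreover have near: "\<forall>\<^sub>F z in at z' within {z. fst z = 1}. fst z = 1 \<and> angle z z' = snd z - snd z' \<and> snd z \<noteq> snd z'"
    if "fst z' = 1"
    using that by (auto simp: eventually_at_filter angle_def prod_eq_iff)
  moreover have "ope_sim (at z' within {z. angle iota z = 1}) ?Q
       (\<lambda>z. mult_current
          (\<lambda>t. \<i> powi (int (wt m p) - 2) / (snd z - snd z') /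
               angle iota (sect s t) powi (int (wt m p) - 2)) ?PB)" if "angle iota z' = 1"
  proof (rule ope_sim_eventually_eq)
    fix \<phi> assume \<phi>: "test_fun \<phi>"
    have z': "fst z' = 1" using that by (simp add: iota)
    have inv: "s powi (2 - int (wt m p)) = 1 / s powi (int (wt m p) - 2)"
      by (metis minus_diff_eq power_int_minus inverse_eq_divide)
    show "\<forall>\<^sub>F z in at z' within {z. angle iota z = 1}. ?Q z \<phi> = mult_current
          (\<lambda>t. \<i> powi (int (wt m p) - 2) / (snd z - snd z') /
               angle iota (sect s t) powi (int (wt m p) - 2)) ?PB \<phi>"
      using near[OF z'] unfolding iota
    proof eventually_elim
      case (elim z)
      then show ?case
        using charge(1)[of z \<phi> p] \<phi> z' by (simp add: const[OF \<phi>] sect_def inv)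
    qed
  qed
  moreover have "ope_sim (at z' within {z. angle iota z = 1}) ?Q
         (\<lambda>z \<phi>. 1 / (snd z - snd z') *
            celestial_op m p \<Delta> (\<lambda>\<zeta>. cpw m (\<Delta> - of_nat (wt m p) + 2) s z \<zeta> \<mu> \<phi>) zt)"
    if *: "angle iota z' = 1 \<and> zt 1 = 1 \<and> \<Delta> - of_nat (wt m p) \<notin> \<int>\<^sub>\<le>\<^sub>0"
    unfolding ope_sim_def
  proof (intro allI impI)
    fix \<phi> assume \<phi>: "test_fun \<phi>"
    have z': "fst z' = 1" and zt: "zt \<in> patch m \<mu>" using * assms(6) by (simp_all add: iota patch_def)
    obtain L where L: "\<And>x y. norm (\<phi> x - \<phi> y) \<le> L * norm (x - y)"
      using test_fun_lipschitz[OF \<phi>] by blast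
    \<comment> \<open>Everything that does not depend on z: the charge gives
      \<open>C * \<phi> (snd z')\<close> and the celestial operator
      \<open>C * \<phi> (snd z)\<close>, both over \<open>snd z - snd z'\<close>.\<close>
    define C where "C = \<i> powi (int (wt m p) - 2) * \<i> * mellin_factor (\<Delta> + 1) (sq m \<mu> zt) *
      (\<Sum>a\<in>{1..2 * m}. \<Sum>b\<in>{1..2 * m}. eps m a b * pd a (wmon m p) \<mu> * zt b) *
      (s powr (\<Delta> - of_nat (wt m p) + 2 + 1) / (2 * \<i> * s))"
    \<comment> \<open>The \<mu>-derivative leaves the weight \<Delta> + 1 of the delta function
      unchanged. The factor s^(2 - P) of the charge shifts it to \<Delta> - P + 3, the weight in the
      wavefunction of dimension \<Delta> - P + 2.\<close>
    have "s powr (\<Delta> + 1 + of_int (2 - int (wt m p))) = s powr (\<Delta> + 1) * s powr of_int (2 - int (wt m p))"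
      by (rule powr_add)
    then have pw: "s powr (\<Delta> + 1) * s powi (2 - int (wt m p)) = s powr (\<Delta> - of_nat (wt m p) + 2 + 1)"
      using complex_powr_of_int[of s "2 - int (wt m p)"] assms(3) by (simp add: algebra_simps)
    have "\<forall>\<^sub>F z in at z' within {z. fst z = 1}.
        norm (?Q z \<phi> - 1 / (snd z - snd z') *
            celestial_op m p \<Delta> (\<lambda>\<zeta>. cpw m (\<Delta> - of_nat (wt m p) + 2) s z \<zeta> \<mu> \<phi>) zt) \<le> norm C * L * norm (1 :: real)"
      using near[OF z']
    proof eventually_elim
      case (elim z)
      have Q: "?Q z \<phi> = 1 / (snd z - snd z') * (C * \<phi> (snd z'))"
        using charge[of z \<phi> p] \<phi> z' elim unfolding C_def pw[symmetric]
        by (simp add: aff_coord_def mult_ac)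
      have "represents m \<mu> (\<lambda>\<zeta>. cpw m (\<Delta> - of_nat (wt m p) + 2) s z \<zeta> \<mu> \<phi>)
          (s powr (\<Delta> - of_nat (wt m p) + 2 + 1) / (2 * \<i> * s) * \<phi> (snd z)) (\<Delta> - of_nat (wt m p) + 2)"
        using elim assms(3) \<phi> by (simp add: represents_def cpw_eq aff_coord_def)
      from celestial_op_eq[OF assms(1) zt _ this] *
      have "celestial_op m p \<Delta> (\<lambda>\<zeta>. cpw m (\<Delta> - of_nat (wt m p) + 2) s z \<zeta> \<mu> \<phi>) zt = C * \<phi> (snd z)"
        by (simp add: C_def mult_ac)
      then have "?Q z \<phi> - 1 / (snd z - snd z') *
            celestial_op m p \<Delta> (\<lambda>\<zeta>. cpw m (\<Delta> - of_nat (wt m p) + 2) s z \<zeta> \<mu> \<phi>) zt =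
          C * (\<phi> (snd z') - \<phi> (snd z)) / (snd z - snd z')"
        unfolding Q by (simp add: algebra_simps diff_divide_distrib)
      moreover have "norm C * norm (\<phi> (snd z') - \<phi> (snd z)) \<le> norm C * (L * norm (snd z - snd z'))"
        using L[of "snd z'" "snd z"] by (intro mult_left_mono) (simp_all add: norm_minus_commute)
      ultimately show ?case
        using elim by (simp add: norm_mult norm_divide divide_le_eq mult.assoc)
    qed
    then show "(\<lambda>z. ?Q z \<phi> - 1 / (snd z - snd z') *
          celestial_op m p \<Delta> (\<lambda>\<zeta>. cpw m (\<Delta> - of_nat (wt m p) + 2) s z \<zeta> \<mu> \<phi>) zt)
        \<in> O[at z' within {z. angle iota z = 1}](\<lambda>_. 1)"
      unfolding iota by (intro bigoI[where c = "norm C * L"]) simp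
  qed
  ultimately show ?thesis by blast
qed

end
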